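(* The functors $\mathscr A$ and $\mathscr C$ establish a dual equivalence between the algebraic category of $\mathsf V$-algebras (with homomorphisms) and the category of topological $\alpha$-models (with $\alpha$-morphisms).
   Context: A $\mathsf V$-algebra is a Boolean algebra $(C,\wedge,\vee,\to,0,1)$ with a binary operation $\mathbin{\Box\!\!\rightarrow}$ satisfying $x\mathbin{\Box\!\!\rightarrow}x=1$; $((x\mathbin{\Box\!\!\rightarrow}y)\wedge(y\mathbin{\Box\!\!\rightarrow}x))\le((x\mathbin{\Box\!\!\rightarrow}z)\leftrightarrow(y\mathbin{\Box\!\!\rightarrow}z))$; $((x\vee y)\mathbin{\Box\!\!\rightarrow}x)\vee((x\vee y)\mathbin{\Box\!\!\rightarrow}y)\vee(((x\vee y)\mathbin{\Box\!\!\rightarrow}z)\leftrightarrow((x\mathbin{\Box\!\!\rightarrow}z)\wedge(y\mathbin{\Box\!\!\rightarrow}z)))=1$; $x\mathbin{\Box\!\!\rightarrow}(y\wedge z)=(x\mathbin{\Box\!\!\rightarrow}y)\wedge(x\mathbin{\Box\!\!\rightarrow}z)$. A topological $\alpha$-model is $(S,\tau,f)$ with $(S,\tau)$ a Stone space and $f:Cl(S)\times S\to\mathcal P(S)$ ($Cl(S)$ the clopens) such that for clopens $A,B$ and $x\in S$: ($\alpha$1) $f(A,x)\subseteq A$; ($\alpha$2) $f(A,x)\subseteq B$ and $f(B,x)\subseteq A$ imply $f(A,x)=f(B,x)$; ($\alpha$3) $f(A\cup B,x)\subseteq A$, or $f(A\cup B,x)\subseteq B$, or $f(A\cup B,x)=f(A,x)\cup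 f(B,x)$; ($\alpha$4) $\{x:f(A,x)\subseteq B\}$ is clopen; ($\alpha$5) $f(A,x)$ is closed. An $\alpha$-morphism $\varphi:(S,\tau,f)\to(S',\tau',f')$ is a continuous map such that $y\in f(\varphi^{-1}[A'],x)$ implies $\varphi(y)\in f'(A',\varphi(x))$, and $y'\in f'(A',\varphi(x))$ implies there is $y$ with $\varphi(y)=y'$ and $y\in f(\varphi^{-1}[A'],x)$. $\mathscr C$ sends $(S,\tau,f)$ to the Boolean algebra of clopens with $A\mathbin{\Box\!\!\rightarrow}B:=\{x:f(A,x)\subseteq B\}$, and an $\alpha$-morphism $\varphi$ to $A\mapsto\varphi^{-1}[A]$. $\mathscr A$ sends a $\mathsf V$-algebra $\mathbf C$ to its Stone space of ultrafilters with $Y\in f_C(\{X:a\in X\},X)$ iff $\{c:a\mathbin{\Box\!\!\rightarrow}c\in X\}\subseteq Y$, and a homomorphism $h$ to $U\mapsto h^{-1}[U]$. *)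

theory Defs
  imports "HOL-Analysis.Analysis"
begin

section \<open>The category of V-algebras\<close>

record 'a valg =
  car :: "'a set"
  vmeet :: "'a \<Rightarrow> 'a \<Rightarrow> 'a" (infixl "\<sqinter>\<index>" 70)
  vjoin :: "'a \<Rightarrow> 'a \<Rightarrow> 'a" (infixl "\<squnion>\<index>" 65)
  vimp :: "'a \<Rightarrow> 'a \<Rightarrow> 'a" (infixr "\<leadsto>\<index>" 60)
  vzero :: 'a ("\<zero>\<index>")
  vunit :: 'a ("\<one>\<index>")
  vcond :: "'a \<Rightarrow> 'a \<Rightarrow> 'a" (infixr "\<box>\<rightarrow>\<index>" 60)

definition vle :: "'a valg \<Rightarrow> 'a \<Rightarrow> 'a \<Rightarrow> bool" (infix "\<sqsubseteq>\<index>" 50)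
  where "x \<sqsubseteq>\<^bsub>C\<^esub> y \<longleftrightarrow> x \<sqinter>\<^bsub>C\<^esub> y = x"

definition vbiimp :: "'a valg \<Rightarrow> 'a \<Rightarrow> 'a \<Rightarrow> 'a" (infix "\<leftrightarrow>\<index>" 60)
  where "x \<leftrightarrow>\<^bsub>C\<^esub> y = (x \<leadsto>\<^bsub>C\<^esub> y) \<sqinter>\<^bsub>C\<^esub> (y \<leadsto>\<^bsub>C\<^esub> x)"

text \<open>In the signature used here the complement of \<open>x\<close> is \<open>x \<leadsto> \<zero>\<close>. The one-element
  algebra (\<open>\<zero> = \<one>\<close>) is a Boolean algebra; it corresponds to the empty Stone space.\<close>

locale Boolean_alg =
  fixes C :: "'a valg" (structure)
  assumes meet_closed: "\<lbrakk>x \<in> car C; y \<in> car C\<rbrakk> \<Longrightarrow> x \<sqinter> y \<in> car C"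
    and join_closed: "\<lbrakk>x \<in> car C; y \<in> car C\<rbrakk> \<Longrightarrow> x \<squnion> y \<in> car C"
    and imp_closed: "\<lbrakk>x \<in> car C; y \<in> car C\<rbrakk> \<Longrightarrow> x \<leadsto> y \<in> car C"
    and zero_closed: "\<zero> \<in> car C"
    and unit_closed: "\<one> \<in> car C"
    and meet_comm: "\<lbrakk>x \<in> car C; y \<in> car C\<rbrakk> \<Longrightarrow> x \<sqinter> y = y \<sqinter> x"
    and join_comm: "\<lbrakk>x \<in> car C; y \<in> car C\<rbrakk> \<Longrightarrow> x \<squnion> y = y \<squnion> x"
    and meet_assoc: "\<lbrakk>x \<in> car C; y \<in> car C; z \<in> car C\<rbrakk> \<Longrightarrow> (x \<sqinter> y) \<sqinter> z = x \<sqinter> (y \<sqinter> z)"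
    and join_assoc: "\<lbrakk>x \<in> car C; y \<in> car C; z \<in> car C\<rbrakk> \<Longrightarrow> (x \<squnion> y) \<squnion> z = x \<squnion> (y \<squnion> z)"
    and meet_absorb: "\<lbrakk>x \<in> car C; y \<in> car C\<rbrakk> \<Longrightarrow> x \<sqinter> (x \<squnion> y) = x"
    and join_absorb: "\<lbrakk>x \<in> car C; y \<in> car C\<rbrakk> \<Longrightarrow> x \<squnion> (x \<sqinter> y) = x"
    and distrib: "\<lbrakk>x \<in> car C; y \<in> car C; z \<in> car C\<rbrakk>
                    \<Longrightarrow> x \<sqinter> (y \<squnion> z) = (x \<sqinter> y) \<squnion> (x \<sqinter> z)"
    and meet_unit: "x \<in> car C \<Longrightarrow> x \<sqinter> \<one> = x"
    and join_zero: "x \<in> car C \<Longrightarrow> x \<squnion> \<zero> = x"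
    and meet_compl: "x \<in> car C \<Longrightarrow> x \<sqinter> (x \<leadsto> \<zero>) = \<zero>"
    and join_compl: "x \<in> car C \<Longrightarrow> x \<squnion> (x \<leadsto> \<zero>) = \<one>"
    and imp_eq: "\<lbrakk>x \<in> car C; y \<in> car C\<rbrakk> \<Longrightarrow> x \<leadsto> y = (x \<leadsto> \<zero>) \<squnion> y"

locale V_algebra = Boolean_alg +
  assumes cond_closed: "\<lbrakk>x \<in> car C; y \<in> car C\<rbrakk> \<Longrightarrow> x \<box>\<rightarrow> y \<in> car C"
    and cond_refl: "x \<in> car C \<Longrightarrow> x \<box>\<rightarrow> x = \<one>"
    and cond_cong: "\<lbrakk>x \<in> car C; y \<in> car C; z \<in> car C\<rbrakk>
          \<Longrightarrow> (x \<box>\<rightarrow> y) \<sqinter> (y \<box>\<rightarrow> x) \<sqsubseteq> ((x \<box>\<rightarrow> z) \<leftrightarrow> (y \<box>\<rightarrow> z))"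
    and cond_join: "\<lbrakk>x \<in> car C; y \<in> car C; z \<in> car C\<rbrakk>
          \<Longrightarrow> ((x \<squnion> y) \<box>\<rightarrow> x) \<squnion> ((x \<squnion> y) \<box>\<rightarrow> y)
                \<squnion> (((x \<squnion> y) \<box>\<rightarrow> z) \<leftrightarrow> ((x \<box>\<rightarrow> z) \<sqinter> (y \<box>\<rightarrow> z))) = \<one>"
    and cond_meet: "\<lbrakk>x \<in> car C; y \<in> car C; z \<in> car C\<rbrakk>
          \<Longrightarrow> x \<box>\<rightarrow> (y \<sqinter> z) = (x \<box>\<rightarrow> y) \<sqinter> (x \<box>\<rightarrow> z)"

definition VAlg :: "'a valg set"
  where "VAlg = {C. V_algebra C}"

text \<open>Morphisms are extensional functions (\<open>undefined\<close> off the domain), so that equality of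
  morphisms is HOL equality, identities are restrictions of the identity function and
  composition is \<^const>\<open>compose\<close>.\<close>

definition V_hom :: "'a valg \<Rightarrow> 'b valg \<Rightarrow> ('a \<Rightarrow> 'b) set"
  where "V_hom C D = {h \<in> car C \<rightarrow>\<^sub>E car D.
    (\<forall>x\<in>car C. \<forall>y\<in>car C.
        h (x \<sqinter>\<^bsub>C\<^esub> y) = h x \<sqinter>\<^bsub>D\<^esub> h y \<and> h (x \<squnion>\<^bsub>C\<^esub> y) = h x \<squnion>\<^bsub>D\<^esub> h y \<and>
        h (x \<leadsto>\<^bsub>C\<^esub> y) = h x \<leadsto>\<^bsub>D\<^esub> h y \<and> h (x \<box>\<rightarrow>\<^bsub>C\<^esub> y) = h x \<box>\<rightarrow>\<^bsub>D\<^esub> h y) \<and>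
    h \<zero>\<^bsub>C\<^esub> = \<zero>\<^bsub>D\<^esub> \<and> h \<one>\<^bsub>C\<^esub> = \<one>\<^bsub>D\<^esub>}"

definition V_id :: "'a valg \<Rightarrow> 'a \<Rightarrow> 'a"
  where "V_id C = (\<lambda>x\<in>car C. x)"

definition V_comp :: "'a valg \<Rightarrow> ('b \<Rightarrow> 'c) \<Rightarrow> ('a \<Rightarrow> 'b) \<Rightarrow> 'a \<Rightarrow> 'c"
  where "V_comp C g h = compose (car C) g h"

lemma V_id_hom: "C \<in> VAlg \<Longrightarrow> V_id C \<in> V_hom C C"
proof -
  assume "C \<in> VAlg"
  then interpret V_algebra C by (simp add: VAlg_def)
  show ?thesis
    by (auto simp: V_hom_def V_id_def meet_closed join_closed imp_closed cond_closed
        zero_closed unit_closed)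
qed

lemma V_comp_hom:
  assumes "C \<in> VAlg" "h \<in> V_hom C D" "g \<in> V_hom D E"
  shows "V_comp C g h \<in> V_hom C E"
proof -
  interpret V_algebra C using assms by (simp add: VAlg_def)
  have h: "h x \<in> car D" if "x \<in> car C" for x using assms that by (auto simp: V_hom_def)
  show ?thesis using assms h
    by (auto simp: V_hom_def V_comp_def compose_def meet_closed join_closed imp_closed
        cond_closed zero_closed unit_closed)
qed

lemma V_comp_id:
  assumes "h \<in> V_hom C D"
  shows "V_comp C h (V_id C) = h" "V_comp C (V_id D) h = h"
  using assms
  by (auto simp: V_hom_def V_id_def V_comp_def PiE_def intro!: compose_Id Id_compose)

lemma V_comp_assoc:
  assumes "h \<in> V_hom C D"
  shows "V_comp C f (V_comp C g h) = V_comp C (V_comp D f g) h"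
  using assms by (auto simp: V_hom_def V_comp_def intro!: compose_assoc)

definition V_iso :: "'a valg \<Rightarrow> 'b valg \<Rightarrow> ('a \<Rightarrow> 'b) set"
  where "V_iso C D = {h \<in> V_hom C D. \<exists>g\<in>V_hom D C.
    V_comp C g h = V_id C \<and> V_comp D h g = V_id D}"


section \<open>The category of topological alpha-models\<close>

definition clopens :: "'s topology \<Rightarrow> 's set set"
  where "clopens X = {A. openin X A \<and> closedin X A}"

definition stone_space :: "'s topology \<Rightarrow> bool"
  where "stone_space X \<longleftrightarrow> compact_space X \<and> Hausdorff_space X \<and>
    (\<forall>U x. openin X U \<and> x \<in> U \<longrightarrow> (\<exists>A\<in>clopens X. x \<in> A \<and> A \<subseteq> U))"

text \<open>The values \<open>sel S A x\<close> matter only for \<open>A\<close> clopen and \<open>x\<close> a point of the space.\<close>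

record 's amodel =
  topo :: "'s topology"
  sel :: "'s set \<Rightarrow> 's \<Rightarrow> 's set"

abbreviation pts :: "'s amodel \<Rightarrow> 's set"
  where "pts S \<equiv> topspace (topo S)"

abbreviation Cl :: "'s amodel \<Rightarrow> 's set set"
  where "Cl S \<equiv> clopens (topo S)"

locale alpha_model =
  fixes S :: "'s amodel"
  assumes stone: "stone_space (topo S)"
    and alpha1: "\<lbrakk>A \<in> Cl S; x \<in> pts S\<rbrakk> \<Longrightarrow> sel S A x \<subseteq> A"
    and alpha2: "\<lbrakk>A \<in> Cl S; B \<in> Cl S; x \<in> pts S; sel S A x \<subseteq> B; sel S B x \<subseteq> A\<rbrakk>
                   \<Longrightarrow> sel S A x = sel S B x"
    and alpha3: "\<lbrakk>A \<in> Cl S; B \<in> Cl S; x \<in> pts S\<rbrakk>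
                   \<Longrightarrow> sel S (A \<union> B) x \<subseteq> A \<or> sel S (A \<union> B) x \<subseteq> B \<or>
                       sel S (A \<union> B) x = sel S A x \<union> sel S B x"
    and alpha4: "\<lbrakk>A \<in> Cl S; B \<in> Cl S\<rbrakk> \<Longrightarrow> {x \<in> pts S. sel S A x \<subseteq> B} \<in> Cl S"
    and alpha5: "\<lbrakk>A \<in> Cl S; x \<in> pts S\<rbrakk> \<Longrightarrow> closedin (topo S) (sel S A x)"

definition TAM :: "'s amodel set"
  where "TAM = {S. alpha_model S}"

definition preimg :: "'s amodel \<Rightarrow> ('s \<Rightarrow> 't) \<Rightarrow> 't set \<Rightarrow> 's set"
  where "preimg S \<phi> A = {x \<in> pts S. \<phi> x \<in> A}"

definition alpha_hom :: "'s amodel \<Rightarrow> 't amodel \<Rightarrow> ('s \<Rightarrow> 't) set"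
  where "alpha_hom S S' = {\<phi> \<in> extensional (pts S). continuous_map (topo S) (topo S') \<phi> \<and>
    (\<forall>A'\<in>Cl S'. \<forall>x\<in>pts S.
        (\<forall>y. y \<in> sel S (preimg S \<phi> A') x \<longrightarrow> \<phi> y \<in> sel S' A' (\<phi> x)) \<and>
        (\<forall>y'. y' \<in> sel S' A' (\<phi> x) \<longrightarrow> (\<exists>y. \<phi> y = y' \<and> y \<in> sel S (preimg S \<phi> A') x)))}"

definition alpha_id :: "'s amodel \<Rightarrow> 's \<Rightarrow> 's"
  where "alpha_id S = (\<lambda>x\<in>pts S. x)"

definition alpha_comp :: "'s amodel \<Rightarrow> ('t \<Rightarrow> 'u) \<Rightarrow> ('s \<Rightarrow> 't) \<Rightarrow> 's \<Rightarrow> 'u"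
  where "alpha_comp S \<psi> \<phi> = compose (pts S) \<psi> \<phi>"

lemma alpha_id_hom: "S \<in> TAM \<Longrightarrow> alpha_id S \<in> alpha_hom S S"
proof -
  assume "S \<in> TAM"
  then interpret alpha_model S by (simp add: TAM_def)
  have p: "preimg S (alpha_id S) A = A" if "A \<in> Cl S" for A
    using that by (auto simp: preimg_def alpha_id_def clopens_def dest: openin_subset)
  have q: "y \<in> pts S" if "A \<in> Cl S" "x \<in> pts S" "y \<in> sel S A x" for A x y
    using alpha1[OF that(1,2)] that by (auto simp: clopens_def dest: openin_subset)
  have "continuous_map (topo S) (topo S) (alpha_id S)"
    unfolding alpha_id_def by (rule continuous_map_eq[OF continuous_map_id]) auto
  moreover have "alpha_id S \<in> extensional (pts S)"
    by (simp add: alpha_id_def)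
  moreover have "alpha_id S x = x" if "x \<in> pts S" for x
    using that by (simp add: alpha_id_def)
  ultimately show ?thesis
    unfolding alpha_hom_def mem_Collect_eq using p q by metis
qed

lemma preimg_clopen:
  assumes "\<phi> \<in> alpha_hom S S'" "A \<in> Cl S'"
  shows "preimg S \<phi> A \<in> Cl S"
proof -
  have "continuous_map (topo S) (topo S') \<phi>"
    using assms unfolding alpha_hom_def by blast
  then show ?thesis
    using assms(2) unfolding clopens_def preimg_def
    by (simp add: openin_continuous_map_preimage closedin_continuous_map_preimage)
qed

lemma alpha_comp_hom:
  assumes "S \<in> TAM" and \<phi>: "\<phi> \<in> alpha_hom S S'" and \<psi>: "\<psi> \<in> alpha_hom S' S''"
  shows "alpha_comp S \<psi> \<phi> \<in> alpha_hom S S''"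
proof -
  interpret alpha_model S using assms by (simp add: TAM_def)
  have c: "continuous_map (topo S) (topo S') \<phi>" "continuous_map (topo S') (topo S'') \<psi>"
    using \<phi> \<psi> unfolding alpha_hom_def by blast+
  have pt: "\<phi> x \<in> pts S'" if "x \<in> pts S" for x
    using c(1) that by (auto simp: continuous_map_def)
  have c': "continuous_map (topo S) (topo S'') (alpha_comp S \<psi> \<phi>)"
    by (rule continuous_map_eq[OF continuous_map_compose[OF c]])
       (auto simp: alpha_comp_def compose_def)
  have pre: "preimg S (alpha_comp S \<psi> \<phi>) A = preimg S \<phi> (preimg S' \<psi> A)" for A
    using pt by (auto simp: preimg_def alpha_comp_def compose_def)
  have sub: "y \<in> pts S" if "A \<in> Cl S" "x \<in> pts S" "y \<in> sel S A x" for A x y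
    using alpha1[OF that(1,2)] that by (auto simp: clopens_def dest: openin_subset)
  have "(\<forall>y. y \<in> sel S (preimg S (alpha_comp S \<psi> \<phi>) A) x
             \<longrightarrow> alpha_comp S \<psi> \<phi> y \<in> sel S'' A (alpha_comp S \<psi> \<phi> x)) \<and>
        (\<forall>y'. y' \<in> sel S'' A (alpha_comp S \<psi> \<phi> x) \<longrightarrow>
             (\<exists>y. alpha_comp S \<psi> \<phi> y = y' \<and> y \<in> sel S (preimg S (alpha_comp S \<psi> \<phi>) A) x))"
    if A: "A \<in> Cl S''" and x: "x \<in> pts S" for A x
  proof -
    note B = preimg_clopen[OF \<psi> A]
    note D = preimg_clopen[OF \<phi> B]
    have e: "alpha_comp S \<psi> \<phi> y = \<psi> (\<phi> y)" if "y \<in> pts S" for y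
      using that by (simp add: alpha_comp_def compose_def)
    have f1: "\<phi> y \<in> sel S' (preimg S' \<psi> A) (\<phi> x)" if "y \<in> sel S (preimg S \<phi> (preimg S' \<psi> A)) x" for y
      using \<phi> B x that unfolding alpha_hom_def mem_Collect_eq by blast
    have f2: "\<exists>y. \<phi> y = y' \<and> y \<in> sel S (preimg S \<phi> (preimg S' \<psi> A)) x"
      if "y' \<in> sel S' (preimg S' \<psi> A) (\<phi> x)" for y'
      using \<phi> B x that unfolding alpha_hom_def mem_Collect_eq by blast
    have g1: "\<psi> y \<in> sel S'' A (\<psi> (\<phi> x))" if "y \<in> sel S' (preimg S' \<psi> A) (\<phi> x)" for y
      using \<psi> A pt[OF x] that unfolding alpha_hom_def mem_Collect_eq by blast
    have g2: "\<exists>y. \<psi> y = y' \<and> y \<in> sel S' (preimg S' \<psi> A) (\<phi> x)" if "y' \<in> sel S'' A (\<psi> (\<phi> x))" for y'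
      using \<psi> A pt[OF x] that unfolding alpha_hom_def mem_Collect_eq by blast
    show ?thesis
      unfolding pre e[OF x]
    proof (intro conjI allI impI)
      fix y assume "y \<in> sel S (preimg S \<phi> (preimg S' \<psi> A)) x"
      then show "alpha_comp S \<psi> \<phi> y \<in> sel S'' A (\<psi> (\<phi> x))"
        using e[OF sub[OF D x]] g1[OF f1] by simp
    next
      fix z assume "z \<in> sel S'' A (\<psi> (\<phi> x))"
      then obtain y' where y': "\<psi> y' = z" "y' \<in> sel S' (preimg S' \<psi> A) (\<phi> x)"
        using g2 by blast
      then obtain y where y: "\<phi> y = y'" "y \<in> sel S (preimg S \<phi> (preimg S' \<psi> A)) x"
        using f2 by blast
      show "\<exists>y. alpha_comp S \<psi> \<phi> y = z \<and> y \<in> sel S (preimg S \<phi> (preimg S' \<psi> A)) x"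
        using y y' e[OF sub[OF D x y(2)]] by auto
    qed
  qed
  moreover have "alpha_comp S \<psi> \<phi> \<in> extensional (pts S)"
    by (simp add: alpha_comp_def)
  ultimately show ?thesis using c' unfolding alpha_hom_def mem_Collect_eq by blast
qed

lemma alpha_comp_id:
  assumes "\<phi> \<in> alpha_hom S T"
  shows "alpha_comp S \<phi> (alpha_id S) = \<phi>" "alpha_comp S (alpha_id T) \<phi> = \<phi>"
proof -
  have "\<phi> \<in> extensional (pts S)" "\<phi> \<in> pts S \<rightarrow> pts T"
    using assms unfolding alpha_hom_def continuous_map_def by blast+
  then show "alpha_comp S \<phi> (alpha_id S) = \<phi>" "alpha_comp S (alpha_id T) \<phi> = \<phi>"
    unfolding alpha_id_def alpha_comp_def by (simp_all add: compose_Id Id_compose)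
qed

lemma alpha_comp_assoc:
  assumes "\<phi> \<in> alpha_hom S T"
  shows "alpha_comp S \<theta> (alpha_comp S \<psi> \<phi>) = alpha_comp S (alpha_comp T \<theta> \<psi>) \<phi>"
proof -
  have "\<phi> \<in> pts S \<rightarrow> pts T"
    using assms unfolding alpha_hom_def continuous_map_def by blast
  then show ?thesis
    unfolding alpha_comp_def by (rule compose_assoc)
qed

definition alpha_iso :: "'s amodel \<Rightarrow> 't amodel \<Rightarrow> ('s \<Rightarrow> 't) set"
  where "alpha_iso S T = {\<phi> \<in> alpha_hom S T. \<exists>\<psi>\<in>alpha_hom T S.
    alpha_comp S \<psi> \<phi> = alpha_id S \<and> alpha_comp T \<phi> \<psi> = alpha_id T}"


section \<open>The functor from topological alpha-models to V-algebras\<close>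

definition C_obj :: "'s amodel \<Rightarrow> 's set valg"
  where "C_obj S = \<lparr>car = Cl S, vmeet = (\<inter>), vjoin = (\<union>), vimp = (\<lambda>A B. (pts S - A) \<union> B),
    vzero = {}, vunit = pts S, vcond = (\<lambda>A B. {x \<in> pts S. sel S A x \<subseteq> B})\<rparr>"

text \<open>The action on a morphism from \<open>S\<close> to \<open>S'\<close>; the result goes from \<open>C_obj S'\<close> to \<open>C_obj S\<close>.\<close>

definition C_map :: "'s amodel \<Rightarrow> 't amodel \<Rightarrow> ('s \<Rightarrow> 't) \<Rightarrow> 't set \<Rightarrow> 's set"
  where "C_map S S' \<phi> = (\<lambda>A\<in>Cl S'. preimg S \<phi> A)"


section \<open>The functor from V-algebras to topological alpha-models\<close>

definition proper_filter :: "'a valg \<Rightarrow> 'a set \<Rightarrow> bool"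
  where "proper_filter C F \<longleftrightarrow> F \<subseteq> car C \<and> \<one>\<^bsub>C\<^esub> \<in> F \<and> \<zero>\<^bsub>C\<^esub> \<notin> F \<and>
    (\<forall>x\<in>F. \<forall>y\<in>F. x \<sqinter>\<^bsub>C\<^esub> y \<in> F) \<and> (\<forall>x\<in>F. \<forall>y\<in>car C. x \<sqsubseteq>\<^bsub>C\<^esub> y \<longrightarrow> y \<in> F)"

definition Ult :: "'a valg \<Rightarrow> 'a set set"
  where "Ult C = {U. proper_filter C U \<and> (\<forall>F. proper_filter C F \<and> U \<subseteq> F \<longrightarrow> F = U)}"

definition stone_set :: "'a valg \<Rightarrow> 'a \<Rightarrow> 'a set set"
  where "stone_set C a = {X \<in> Ult C. a \<in> X}"

text \<open>A clopen of the Stone space is \<open>stone_set C a\<close> for exactly one \<open>a \<in> car C\<close>, so the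
  existential quantifier over \<open>a\<close> below only recovers \<open>a\<close> from the clopen \<open>A\<close>.\<close>

definition A_obj :: "'a valg \<Rightarrow> 'a set amodel"
  where "A_obj C = \<lparr>topo = topology_generated_by (stone_set C ` car C),
    sel = (\<lambda>A X. {Y \<in> Ult C. \<exists>a\<in>car C. A = stone_set C a \<and> {c \<in> car C. a \<box>\<rightarrow>\<^bsub>C\<^esub> c \<in> X} \<subseteq> Y})\<rparr>"

text \<open>The action on a homomorphism from \<open>C\<close> to \<open>D\<close>; the result goes from \<open>A_obj D\<close> to \<open>A_obj C\<close>.\<close>

definition A_map :: "'a valg \<Rightarrow> 'b valg \<Rightarrow> ('a \<Rightarrow> 'b) \<Rightarrow> 'b set \<Rightarrow> 'a set"
  where "A_map C D h = (\<lambda>U\<in>Ult D. {a \<in> car C. h a \<in> U})"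


section \<open>The canonical transformations\<close>

text \<open>The points of \<open>A_obj C\<close> live in \<open>'a set\<close> when \<open>C\<close> lives in \<open>'a\<close>, so no single HOL type carries
  both composite functors as endofunctors. A statement about \<open>VAlg\<close> or \<open>TAM\<close> is
  therefore made for algebras and spaces over arbitrary, possibly different, types.\<close>

definition eta :: "'a valg \<Rightarrow> 'a \<Rightarrow> 'a set set"
  where "eta C = (\<lambda>a\<in>car C. stone_set C a)"

definition eps :: "'s amodel \<Rightarrow> 's \<Rightarrow> 's set set"
  where "eps S = (\<lambda>x\<in>pts S. {A \<in> Cl S. x \<in> A})"

end

theory Submission
  imports Defs
begin

text \<open>On the Boolean side this is Stone duality. The conditional is recovered from the selection
  function because, for an ultrafilter \<open>X\<close>, the set of all \<open>c\<close> with \<open>a \<box>\<rightarrow> c \<in> X\<close> is a filter, and by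
  the ultrafilter theorem \<open>a \<box>\<rightarrow> b \<in> X\<close> iff every ultrafilter above this filter contains \<open>b\<close>; on
  ultrafilters the two conditional axioms then become (\<open>\<alpha>2\<close>) and (\<open>\<alpha>3\<close>), the latter by primeness.
  Conversely, the selection function is recovered from the conditional because a closed subset of
  a Stone space is the intersection of the clopens containing it. For the second condition on
  \<open>\<alpha>\<close>-morphisms, a point \<open>Y'\<close> selected at the pullback of \<open>U\<close> along \<open>h\<close> is lifted by extending
  the union of \<open>h[Y']\<close> and the filter of \<open>h a\<close> at \<open>U\<close> to an ultrafilter.\<close>


section \<open>Ultrafilters of a Boolean algebra\<close>

context Boolean_alg
begin

section \<open>Order and meet laws derived from the lattice axioms\<close>

lemma meet_idem: "x \<in> car C \<Longrightarrow> x \<sqinter> x = x"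
  using meet_absorb[of x "x \<sqinter> x"] join_absorb[of x x] by (simp add: meet_closed)

lemma meet_zero: "x \<in> car C \<Longrightarrow> \<zero> \<sqinter> x = \<zero>"
  using join_absorb[of "\<zero>" x] join_comm[of "\<zero>" "\<zero> \<sqinter> x"] join_zero[of "\<zero> \<sqinter> x"]
  by (simp add: meet_closed zero_closed)

lemma compl_closed: "x \<in> car C \<Longrightarrow> x \<leadsto> \<zero> \<in> car C"
  by (simp add: imp_closed zero_closed)

lemma le_trans: "\<lbrakk>x \<in> car C; y \<in> car C; z \<in> car C; x \<sqsubseteq> y; y \<sqsubseteq> z\<rbrakk> \<Longrightarrow> x \<sqsubseteq> z"
  unfolding vle_def by (metis meet_assoc)

lemma le_antisym: "\<lbrakk>x \<in> car C; y \<in> car C; x \<sqsubseteq> y; y \<sqsubseteq> x\<rbrakk> \<Longrightarrow> x = y"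
  unfolding vle_def by (metis meet_comm)

lemma meet_le1: "\<lbrakk>x \<in> car C; y \<in> car C\<rbrakk> \<Longrightarrow> x \<sqinter> y \<sqsubseteq> x"
  unfolding vle_def by (metis meet_assoc meet_comm meet_idem meet_closed)

lemma meet_le2: "\<lbrakk>x \<in> car C; y \<in> car C\<rbrakk> \<Longrightarrow> x \<sqinter> y \<sqsubseteq> y"
  unfolding vle_def by (metis meet_assoc meet_idem)

lemma meet_interchange:
  assumes "a \<in> car C" "b \<in> car C" "x \<in> car C" "y \<in> car C"
  shows "(a \<sqinter> b) \<sqinter> (x \<sqinter> y) = (a \<sqinter> x) \<sqinter> (b \<sqinter> y)"
proof -
  have "b \<sqinter> (x \<sqinter> y) = x \<sqinter> (b \<sqinter> y)"
    using assms meet_assoc[of b x y] meet_assoc[of x b y] meet_comm[of b x] by simp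
  then show ?thesis using assms by (simp add: meet_assoc meet_closed)
qed

lemma meet_mono:
  assumes "a \<in> car C" "b \<in> car C" "x \<in> car C" "y \<in> car C" "a \<sqsubseteq> x" "b \<sqsubseteq> y"
  shows "a \<sqinter> b \<sqsubseteq> x \<sqinter> y"
using assms meet_interchange[of a b x y] by (simp add: vle_def)

lemma le_join1: "\<lbrakk>x \<in> car C; y \<in> car C\<rbrakk> \<Longrightarrow> x \<sqsubseteq> x \<squnion> y"
  by (simp add: vle_def meet_absorb)

lemma le_join2: "\<lbrakk>x \<in> car C; y \<in> car C\<rbrakk> \<Longrightarrow> y \<sqsubseteq> x \<squnion> y"
  using le_join1[of y x] by (simp add: join_comm)

lemma zero_le: "x \<in> car C \<Longrightarrow> \<zero> \<sqsubseteq> x"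
  by (simp add: vle_def meet_zero)

lemma le_zero: "\<lbrakk>x \<in> car C; x \<sqsubseteq> \<zero>\<rbrakk> \<Longrightarrow> x = \<zero>"
  by (simp add: le_antisym zero_closed zero_le)

lemma le_unit: "x \<in> car C \<Longrightarrow> x \<sqsubseteq> \<one>"
  by (simp add: vle_def meet_unit)

lemma le_if_meet_compl:
  assumes "x \<in> car C" "y \<in> car C" "x \<sqinter> (y \<leadsto> \<zero>) = \<zero>"
  shows "x \<sqsubseteq> y"
proof -
  have "x = x \<sqinter> (y \<squnion> (y \<leadsto> \<zero>))"
    using assms by (simp add: join_compl meet_unit)
  also have "\<dots> = x \<sqinter> y"
    using assms by (simp add: distrib compl_closed join_zero meet_closed)
  finally show ?thesis by (simp add: vle_def)
qed

text \<open>Zorn's lemma among the proper filters above \<open>F\<close>. A maximal element there is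
  maximal among all proper filters, since every proper filter above it is also above
  \<open>F\<close>.\<close>

lemma proper_filter_extends:
  assumes "proper_filter C F"
  shows "\<exists>U\<in>Ult C. F \<subseteq> U"
proof -
  let ?A = "{G. proper_filter C G \<and> F \<subseteq> G}"
  have "\<exists>U\<in>?A. \<forall>X\<in>?A. U \<subseteq> X \<longrightarrow> X = U"
  proof (rule subset_Zorn_nonempty)
    show "?A \<noteq> {}" using assms by blast
    fix K assume ne: "K \<noteq> {}" and ch: "subset.chain ?A K"
    have mem: "proper_filter C G" "F \<subseteq> G" if "G \<in> K" for G
      using ch that by (auto simp: subset_chain_def)
    have meetI: "x \<sqinter> y \<in> G" if "G \<in> K" "x \<in> G" "y \<in> G" for x y G
      using mem(1)[OF that(1)] that(2,3) by (simp add: proper_filter_def)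
    have upI: "y \<in> G" if "G \<in> K" "x \<in> G" "y \<in> car C" "x \<sqsubseteq> y" for x y G
      using mem(1)[OF that(1)] that(2-4) by (auto simp: proper_filter_def)
    have "\<Union>K \<subseteq> car C" "\<zero> \<notin> \<Union>K"
      using mem(1) by (fastforce simp: proper_filter_def)+
    moreover have "\<one> \<in> \<Union>K" "F \<subseteq> \<Union>K"
      using mem ne by (auto simp: proper_filter_def)
    moreover have "\<forall>x\<in>\<Union>K. \<forall>y\<in>\<Union>K. x \<sqinter> y \<in> \<Union>K"
    proof (intro ballI, elim UnionE)
      fix x y G H assume xy: "x \<in> G" "G \<in> K" "y \<in> H" "H \<in> K"
      have "G \<subseteq> H \<or> H \<subseteq> G" using ch xy by (auto simp: subset_chain_def)
      then show "x \<sqinter> y \<in> \<Union>K"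
        using xy meetI[OF xy(2), of x y] meetI[OF xy(4), of x y] by blast
    qed
    moreover have "\<forall>x\<in>\<Union>K. \<forall>y\<in>car C. x \<sqsubseteq> y \<longrightarrow> y \<in> \<Union>K"
      using upI by blast
    ultimately show "\<Union>K \<in> ?A" by (simp add: proper_filter_def)
  qed
  then obtain U where U: "U \<in> ?A" "\<forall>X\<in>?A. U \<subseteq> X \<longrightarrow> X = U" by blast
  then have "U \<in> Ult C" unfolding Ult_def by auto
  then show ?thesis using U by blast
qed

text \<open>Since \<open>F\<close> and \<open>G\<close> are meet-closed, the filter generated by
  their union needs only meets of one element from each, and \<open>FG\<close> keeps
  \<open>\<zero>\<close> out of it. This two-set form serves for complements, separation, clopens
  and the lifting of ultrafilters along homomorphisms.\<close>

lemma ultrafilter_extends: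
  assumes F: "F \<subseteq> car C" "F \<noteq> {}" "\<And>x y. \<lbrakk>x \<in> F; y \<in> F\<rbrakk> \<Longrightarrow> x \<sqinter> y \<in> F"
    and G: "G \<subseteq> car C" "G \<noteq> {}" "\<And>x y. \<lbrakk>x \<in> G; y \<in> G\<rbrakk> \<Longrightarrow> x \<sqinter> y \<in> G"
    and FG: "\<And>x y. \<lbrakk>x \<in> F; y \<in> G\<rbrakk> \<Longrightarrow> x \<sqinter> y \<noteq> \<zero>"
  shows "\<exists>U\<in>Ult C. F \<subseteq> U \<and> G \<subseteq> U"
proof -
  define H where "H = {z \<in> car C. \<exists>x\<in>F. \<exists>y\<in>G. x \<sqinter> y \<sqsubseteq> z}"
  have HI: "z \<in> H" if "z \<in> car C" "x \<in> F" "y \<in> G" "x \<sqinter> y \<sqsubseteq> z" for x y z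
    using that unfolding H_def by blast
  obtain f g where fg: "f \<in> F" "g \<in> G" using F(2) G(2) by blast
  have car: "x \<in> F \<Longrightarrow> x \<in> car C" "y \<in> G \<Longrightarrow> y \<in> car C" for x y
    using F(1) G(1) by blast+
  have "proper_filter C H"
    unfolding proper_filter_def
  proof (intro conjI ballI impI)
    show "H \<subseteq> car C" by (auto simp: H_def)
    show "\<one> \<in> H" using fg car by (intro HI[OF unit_closed fg] le_unit meet_closed) auto
    show "\<zero> \<notin> H"
      using FG le_zero[OF meet_closed] car by (fastforce simp: H_def)
  next
    fix z w assume "z \<in> H" "w \<in> H"
    then obtain x y x' y' where *: "x \<in> F" "y \<in> G" "x \<sqinter> y \<sqsubseteq> z" "x' \<in> F" "y' \<in> G" "x' \<sqinter> y' \<sqsubseteq> w"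
      and zw: "z \<in> car C" "w \<in> car C"
      unfolding H_def by blast
    have "(x \<sqinter> x') \<sqinter> (y \<sqinter> y') = (x \<sqinter> y) \<sqinter> (x' \<sqinter> y')"
      using car * by (simp add: meet_interchange)
    moreover have "(x \<sqinter> y) \<sqinter> (x' \<sqinter> y') \<sqsubseteq> z \<sqinter> w"
      using * zw car by (intro meet_mono) (auto intro: meet_closed)
    ultimately show "z \<sqinter> w \<in> H"
      using HI[of "z \<sqinter> w" "x \<sqinter> x'" "y \<sqinter> y'"] * zw F(3) G(3) by (simp add: meet_closed)
  next
    fix z w assume "z \<in> H" "w \<in> car C" "z \<sqsubseteq> w"
    then show "w \<in> H"
      using car le_trans[OF meet_closed, of _ _ z w] unfolding H_def by blast
  qed
  then obtain U where U: "U \<in> Ult C" "H \<subseteq> U" using proper_filter_extends by blast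
  have "F \<subseteq> H" using car fg HI[OF _ _ _ meet_le1] by blast
  moreover have "G \<subseteq> H" using car fg HI[OF _ _ _ meet_le2] by blast
  ultimately show ?thesis using U by blast
qed

section \<open>Membership rules for ultrafilters\<close>

lemma Ult_car: "\<lbrakk>U \<in> Ult C; x \<in> U\<rbrakk> \<Longrightarrow> x \<in> car C"
  by (auto simp: Ult_def proper_filter_def)

lemma Ult_unit: "U \<in> Ult C \<Longrightarrow> \<one> \<in> U"
  by (auto simp: Ult_def proper_filter_def)

lemma Ult_zero: "U \<in> Ult C \<Longrightarrow> \<zero> \<notin> U"
  by (auto simp: Ult_def proper_filter_def)

lemma Ult_up: "\<lbrakk>U \<in> Ult C; x \<in> U; y \<in> car C; x \<sqsubseteq> y\<rbrakk> \<Longrightarrow> y \<in> U"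
  unfolding Ult_def proper_filter_def by blast

lemma Ult_maximal: "\<lbrakk>U \<in> Ult C; V \<in> Ult C; U \<subseteq> V\<rbrakk> \<Longrightarrow> U = V"
  unfolding Ult_def by blast

text \<open>If a larger proper filter had an element \<open>x\<close> outside \<open>U\<close>, it
  would also contain the complement of \<open>x\<close>, hence \<open>\<zero>\<close>.\<close>

lemma UltI:
  assumes U: "proper_filter C U" and "\<And>x. x \<in> car C \<Longrightarrow> x \<in> U \<or> x \<leadsto> \<zero> \<in> U"
  shows "U \<in> Ult C"
proof -
  have "x \<in> U" if F: "proper_filter C F" "U \<subseteq> F" and x: "x \<in> F" for F x
  proof (rule ccontr)
    assume "x \<notin> U"
    moreover have "x \<in> car C" using F x by (auto simp: proper_filter_def)
    ultimately have "x \<leadsto> \<zero> \<in> F" using assms(2) F by blast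
    then have "x \<sqinter> (x \<leadsto> \<zero>) \<in> F" using F x by (simp add: proper_filter_def)
    then show False using F \<open>x \<in> car C\<close> by (simp add: meet_compl proper_filter_def)
  qed
  then show ?thesis using U unfolding Ult_def by blast
qed

lemma Ult_meetI: "\<lbrakk>U \<in> Ult C; x \<in> U; y \<in> U\<rbrakk> \<Longrightarrow> x \<sqinter> y \<in> U"
  unfolding Ult_def proper_filter_def by blast

lemma Ult_meet: "\<lbrakk>U \<in> Ult C; x \<in> car C; y \<in> car C\<rbrakk> \<Longrightarrow> x \<sqinter> y \<in> U \<longleftrightarrow> x \<in> U \<and> y \<in> U"
  by (meson Ult_meetI Ult_up meet_closed meet_le1 meet_le2)

text \<open>An element and its complement meet in \<open>\<zero>\<close>, so both cannot lie in
  \<open>U\<close>. If \<open>x\<close> is missing, nothing in \<open>U\<close> lies below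
  \<open>x\<close>, so every element of \<open>U\<close> is compatible with the complement; an
  ultrafilter containing both exists and equals \<open>U\<close> by maximality.\<close>

lemma Ult_compl:
  assumes U: "U \<in> Ult C" and x: "x \<in> car C"
  shows "x \<leadsto> \<zero> \<in> U \<longleftrightarrow> x \<notin> U"
proof
  assume "x \<leadsto> \<zero> \<in> U"
  then show "x \<notin> U" using Ult_meetI[OF U, of x "x \<leadsto> \<zero>"] Ult_zero[OF U] x by (auto simp: meet_compl)
next
  assume nx: "x \<notin> U"
  have "y \<sqinter> (x \<leadsto> \<zero>) \<noteq> \<zero>" if "y \<in> U" for y
    using le_if_meet_compl[of y x] Ult_up[OF U that x] nx x Ult_car[OF U that] by blast
  then have "\<exists>V\<in>Ult C. U \<subseteq> V \<and> {x \<leadsto> \<zero>} \<subseteq> V"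
    using U x by (intro ultrafilter_extends)
      (auto intro: Ult_car Ult_meetI dest: Ult_unit simp: compl_closed meet_idem)
  then show "x \<leadsto> \<zero> \<in> U" using Ult_maximal[OF U] by blast
qed

text \<open>Primeness: distributivity reduces the meet of \<open>x \<squnion> y\<close> with the
  complement of \<open>x\<close> to a meet below \<open>y\<close>.\<close>

lemma Ult_join:
  assumes U: "U \<in> Ult C" and x: "x \<in> car C" and y: "y \<in> car C"
  shows "x \<squnion> y \<in> U \<longleftrightarrow> x \<in> U \<or> y \<in> U"
proof
  assume xy: "x \<squnion> y \<in> U"
  show "x \<in> U \<or> y \<in> U"
  proof (cases "x \<in> U")
    case False
    then have "(x \<leadsto> \<zero>) \<sqinter> (x \<squnion> y) \<in> U" using xy U x by (intro Ult_meetI) (auto simp: Ult_compl)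
    also have "(x \<leadsto> \<zero>) \<sqinter> (x \<squnion> y) = \<zero> \<squnion> ((x \<leadsto> \<zero>) \<sqinter> y)"
      using x y meet_comm[of "x \<leadsto> \<zero>" x] by (simp add: distrib compl_closed meet_compl)
    also have "\<dots> = (x \<leadsto> \<zero>) \<sqinter> y"
      using x y by (metis join_comm join_zero compl_closed meet_closed zero_closed)
    finally show ?thesis using U x y by (simp add: Ult_meet compl_closed)
  qed simp
next
  show "x \<in> U \<or> y \<in> U \<Longrightarrow> x \<squnion> y \<in> U"
    using U x y by (meson Ult_up join_closed le_join1 le_join2)
qed

lemma Ult_imp:
  assumes "U \<in> Ult C" "x \<in> car C" "y \<in> car C"
  shows "x \<leadsto> y \<in> U \<longleftrightarrow> (x \<in> U \<longrightarrow> y \<in> U)"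
  using assms imp_eq[of x y] by (auto simp: Ult_join compl_closed Ult_compl)

lemma Ult_biimp:
  assumes "U \<in> Ult C" "x \<in> car C" "y \<in> car C"
  shows "x \<leftrightarrow> y \<in> U \<longleftrightarrow> (x \<in> U \<longleftrightarrow> y \<in> U)"
  using assms by (auto simp: vbiimp_def Ult_meet imp_closed Ult_imp)

lemma biimp_closed: "\<lbrakk>x \<in> car C; y \<in> car C\<rbrakk> \<Longrightarrow> x \<leftrightarrow> y \<in> car C"
  by (simp add: vbiimp_def meet_closed imp_closed)

text \<open>No element of \<open>F\<close> lies below \<open>b\<close>, which says exactly that
  \<open>F\<close> is compatible with the complement of \<open>b\<close>; extend the two
  together.\<close>

lemma Ult_separates:
  assumes "F \<subseteq> car C" "F \<noteq> {}" "\<And>x y. \<lbrakk>x \<in> F; y \<in> F\<rbrakk> \<Longrightarrow> x \<sqinter> y \<in> F"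
    and "b \<in> car C" "\<And>x. x \<in> F \<Longrightarrow> \<not> x \<sqsubseteq> b"
  shows "\<exists>U\<in>Ult C. F \<subseteq> U \<and> b \<notin> U"
proof -
  have "x \<sqinter> (b \<leadsto> \<zero>) \<noteq> \<zero>" if "x \<in> F" for x
    using le_if_meet_compl[of x b] assms that by blast
  then have "\<exists>U\<in>Ult C. F \<subseteq> U \<and> {b \<leadsto> \<zero>} \<subseteq> U"
    using assms(1-4) by (intro ultrafilter_extends) (auto simp: compl_closed meet_idem)
  then show ?thesis using Ult_compl assms(4) by blast
qed

lemma stone_set_subset_iff:
  assumes "a \<in> car C" "b \<in> car C"
  shows "stone_set C a \<subseteq> stone_set C b \<longleftrightarrow> a \<sqsubseteq> b"
proof
  assume sub: "stone_set C a \<subseteq> stone_set C b"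
  show "a \<sqsubseteq> b"
    using Ult_separates[of "{a}" b] assms sub by (auto simp: stone_set_def meet_idem)
qed (auto simp: stone_set_def intro: Ult_up assms)

text \<open>This makes the element \<open>a\<close> hidden in the selection function of
  \<open>A_obj C\<close> unique, and later gives injectivity of \<open>eta C\<close>.\<close>

lemma stone_set_inj: "\<lbrakk>a \<in> car C; b \<in> car C\<rbrakk> \<Longrightarrow> stone_set C a = stone_set C b \<longleftrightarrow> a = b"
  by (metis le_antisym order_refl stone_set_subset_iff)

section \<open>Boolean operations as set operations on ultrafilters\<close>

lemma stone_set_unit: "stone_set C \<one> = Ult C"
  by (auto simp: stone_set_def Ult_unit)

lemma stone_set_zero: "stone_set C \<zero> = {}"
  by (auto simp: stone_set_def Ult_zero)

lemma stone_set_meet: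
  "\<lbrakk>a \<in> car C; b \<in> car C\<rbrakk> \<Longrightarrow> stone_set C (a \<sqinter> b) = stone_set C a \<inter> stone_set C b"
  by (auto simp: stone_set_def Ult_meet)

lemma stone_set_join:
  "\<lbrakk>a \<in> car C; b \<in> car C\<rbrakk> \<Longrightarrow> stone_set C (a \<squnion> b) = stone_set C a \<union> stone_set C b"
  by (auto simp: stone_set_def Ult_join)

lemma stone_set_imp:
  "\<lbrakk>a \<in> car C; b \<in> car C\<rbrakk> \<Longrightarrow> stone_set C (a \<leadsto> b) = (Ult C - stone_set C a) \<union> stone_set C b"
  by (auto simp: stone_set_def Ult_imp)

lemma stone_set_compl: "a \<in> car C \<Longrightarrow> stone_set C (a \<leadsto> \<zero>) = Ult C - stone_set C a"
  by (auto simp: stone_set_def Ult_compl)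


section \<open>The Stone space of a Boolean algebra\<close>

lemma pts_A_obj: "pts (A_obj C) = Ult C"
proof -
  have "\<Union>(stone_set C ` car C) = Ult C"
    using stone_set_unit unit_closed by (auto simp: stone_set_def)
  then show ?thesis by (simp add: A_obj_def)
qed

lemma openin_stone_set: "a \<in> car C \<Longrightarrow> openin (topo (A_obj C)) (stone_set C a)"
  by (auto simp: A_obj_def intro: topology_generated_by_Basis)

text \<open>The generating family is a priori only a subbasis; it is a base because it is closed
  under binary intersection by \<open>stone_set_meet\<close>.\<close>

lemma openin_A_obj_base:
  assumes "openin (topo (A_obj C)) W" "X \<in> W"
  shows "\<exists>a\<in>car C. X \<in> stone_set C a \<and> stone_set C a \<subseteq> W"
proof -
  have "generate_topology_on (stone_set C ` car C) W"
    using assms(1) by (simp add: A_obj_def openin_topology_generated_by_iff)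
  then show ?thesis using assms(2)
  proof (induction arbitrary: X)
    case (Int V W)
    then obtain a b where "a \<in> car C" "X \<in> stone_set C a" "stone_set C a \<subseteq> V"
      "b \<in> car C" "X \<in> stone_set C b" "stone_set C b \<subseteq> W" by blast
    then show ?case by (intro bexI[of _ "a \<sqinter> b"]) (auto simp: stone_set_meet meet_closed)
  next
    case (UN K)
    then obtain k where "k \<in> K" "X \<in> k" by blast
    then show ?case using UN.IH by blast
  qed auto
qed

text \<open>For the hard inclusion, let \<open>F\<close> index the basic sets covering
  \<open>A\<close> and \<open>G\<close> those covering its complement. No ultrafilter contains both,
  so by \<open>ultrafilter_extends\<close> some \<open>x\<close> in \<open>F\<close> and
  \<open>y\<close> in \<open>G\<close> are disjoint, and \<open>x\<close> represents
  \<open>A\<close>.\<close>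

lemma clopens_A_obj: "Cl (A_obj C) = stone_set C ` car C"
proof
  have "openin (topo (A_obj C)) (Ult C - stone_set C a)" if "a \<in> car C" for a
    using openin_stone_set[OF compl_closed[OF that]] stone_set_compl[OF that] by simp
  moreover have "stone_set C a \<subseteq> Ult C" for a
    by (auto simp: stone_set_def)
  ultimately show "stone_set C ` car C \<subseteq> Cl (A_obj C)"
    using openin_stone_set by (auto simp: clopens_def closedin_def pts_A_obj)
next
  show "Cl (A_obj C) \<subseteq> stone_set C ` car C"
  proof
    fix A assume "A \<in> Cl (A_obj C)"
    then have op: "openin (topo (A_obj C)) A" "openin (topo (A_obj C)) (Ult C - A)" and sub: "A \<subseteq> Ult C"
      by (auto simp: clopens_def closedin_def pts_A_obj)
    define F where "F = {c \<in> car C. A \<subseteq> stone_set C c}"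
    define G where "G = {c \<in> car C. Ult C - A \<subseteq> stone_set C c}"
    have "\<not> (F \<subseteq> U \<and> G \<subseteq> U)" if U: "U \<in> Ult C" for U
    proof (cases "U \<in> A")
      case True
      then obtain a where a: "a \<in> car C" "U \<in> stone_set C a" "stone_set C a \<subseteq> A"
        using openin_A_obj_base[OF op(1)] by blast
      \<comment> \<open>A basic neighbourhood of \<open>U\<close> inside \<open>A\<close> has a
        complement that covers the complement of \<open>A\<close>; so \<open>G\<close> contains an
        element missing from \<open>U\<close>.\<close>
      then have "a \<leadsto> \<zero> \<in> G" by (auto simp: G_def compl_closed stone_set_compl)
      then show ?thesis using a U by (auto simp: stone_set_def Ult_compl)
    next
      case False
      then obtain a where a: "a \<in> car C" "U \<in> stone_set C a" "stone_set C a \<subseteq> Ult C - A"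
        using openin_A_obj_base[OF op(2)] U by blast
      then have "a \<leadsto> \<zero> \<in> F" using sub by (auto simp: F_def compl_closed stone_set_compl)
      then show ?thesis using a U by (auto simp: stone_set_def Ult_compl)
    qed
    moreover have "\<one> \<in> F" "\<one> \<in> G" using sub by (auto simp: F_def G_def stone_set_unit unit_closed)
    moreover have "F \<subseteq> car C" "G \<subseteq> car C" by (auto simp: F_def G_def)
    moreover have "x \<sqinter> y \<in> F" if "x \<in> F" "y \<in> F" for x y
      using that by (auto simp: F_def stone_set_meet meet_closed)
    moreover have "x \<sqinter> y \<in> G" if "x \<in> G" "y \<in> G" for x y
      using that by (auto simp: G_def stone_set_meet meet_closed)
    ultimately obtain x y where xy: "x \<in> F" "y \<in> G" "x \<sqinter> y = \<zero>"
      using ultrafilter_extends[of F G] by blast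
    then have "stone_set C x \<inter> stone_set C y = {}"
      using stone_set_meet[of x y] stone_set_zero by (simp add: F_def G_def)
    then have "A = stone_set C x"
      using xy by (auto simp: F_def G_def stone_set_def)
    then show "A \<in> stone_set C ` car C" using xy by (auto simp: F_def)
  qed
qed

text \<open>The elements whose Stone set has a finitely covered complement satisfy all filter laws
  except possibly properness. If they formed a proper filter, an ultrafilter \<open>X\<close> above
  it would lie in a basic set inside one member of the cover; the complement of that basic element
  would then be in the filter but not in \<open>X\<close>. So \<open>\<zero>\<close> belongs to the
  family, which is a finite subcover.\<close>

lemma compact_A_obj: "compact_space (topo (A_obj C))"
  unfolding compact_space_alt pts_A_obj
proof (intro allI impI, elim conjE)
  fix \<U> assume op: "\<forall>W\<in>\<U>. openin (topo (A_obj C)) W" and cov: "Ult C \<subseteq> \<Union>\<U>"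
  define F where "F = {x \<in> car C. \<exists>T. finite T \<and> T \<subseteq> \<U> \<and> Ult C - stone_set C x \<subseteq> \<Union>T}"
  have "\<zero> \<in> F"
  proof (rule ccontr)
    assume z: "\<zero> \<notin> F"
    have "proper_filter C F"
      unfolding proper_filter_def
    proof (intro conjI ballI impI)
      show "F \<subseteq> car C" "\<zero> \<notin> F" using z by (auto simp: F_def)
      show "\<one> \<in> F" by (auto simp: F_def unit_closed stone_set_unit)
    next
      fix x y assume "x \<in> F" "y \<in> F"
      then obtain T T' where "finite T" "T \<subseteq> \<U>" "Ult C - stone_set C x \<subseteq> \<Union>T"
        "finite T'" "T' \<subseteq> \<U>" "Ult C - stone_set C y \<subseteq> \<Union>T'" "x \<in> car C" "y \<in> car C"
        unfolding F_def by blast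
      then show "x \<sqinter> y \<in> F"
        unfolding F_def by (auto intro!: exI[of _ "T \<union> T'"] simp: meet_closed stone_set_meet)
    next
      fix x y assume "x \<in> F" "y \<in> car C" "x \<sqsubseteq> y"
      moreover from this have "stone_set C x \<subseteq> stone_set C y"
        by (simp add: F_def stone_set_subset_iff)
      ultimately show "y \<in> F" unfolding F_def by blast
    qed
    then obtain X where X: "X \<in> Ult C" "F \<subseteq> X" using proper_filter_extends by blast
    then obtain W where W: "W \<in> \<U>" "X \<in> W" using cov by blast
    then obtain a where a: "a \<in> car C" "X \<in> stone_set C a" "stone_set C a \<subseteq> W"
      using openin_A_obj_base op by blast
    then have "a \<leadsto> \<zero> \<in> F"
      using W by (auto simp: F_def compl_closed stone_set_compl intro!: exI[of _ "{W}"])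
    then show False using X a by (auto simp: stone_set_def Ult_compl)
  qed
  then show "\<exists>\<F>. finite \<F> \<and> \<F> \<subseteq> \<U> \<and> Ult C \<subseteq> \<Union>\<F>"
    by (auto simp: F_def stone_set_zero)
qed

text \<open>Distinct ultrafilters are incomparable by maximality, so an element of one is missing
  from the other; it and its complement give disjoint neighbourhoods.\<close>

lemma stone_space_A_obj: "stone_space (topo (A_obj C))"
  unfolding stone_space_def
proof (intro conjI allI impI compact_A_obj)
  show "Hausdorff_space (topo (A_obj C))"
    unfolding Hausdorff_space_def pts_A_obj
  proof (intro allI impI, elim conjE)
    fix X Y assume XY: "X \<in> Ult C" "Y \<in> Ult C" "X \<noteq> Y"
    then obtain a where a: "a \<in> X" "a \<notin> Y" using Ult_maximal by blast
    then have "a \<in> car C" using XY Ult_car by blast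
    then show "\<exists>U V. openin (topo (A_obj C)) U \<and> openin (topo (A_obj C)) V \<and> X \<in> U \<and> Y \<in> V \<and> disjnt U V"
      using a XY openin_stone_set
      by (intro exI[of _ "stone_set C a"] exI[of _ "stone_set C (a \<leadsto> \<zero>)"])
         (auto simp: stone_set_def Ult_compl compl_closed disjnt_iff)
  qed
next
  fix W X assume "openin (topo (A_obj C)) W \<and> X \<in> W"
  then show "\<exists>A\<in>clopens (topo (A_obj C)). X \<in> A \<and> A \<subseteq> W"
    using openin_A_obj_base by (auto simp: clopens_A_obj)
qed

end


section \<open>From V-algebras to topological alpha-models\<close>

context V_algebra
begin

lemma sel_A_obj:
  assumes "a \<in> car C"
  shows "sel (A_obj C) (stone_set C a) X = {Y \<in> Ult C. {c \<in> car C. a \<box>\<rightarrow> c \<in> X} \<subseteq> Y}"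
proof -
  have "(\<exists>a'\<in>car C. stone_set C a = stone_set C a' \<and> {c \<in> car C. a' \<box>\<rightarrow> c \<in> X} \<subseteq> Y)
      \<longleftrightarrow> {c \<in> car C. a \<box>\<rightarrow> c \<in> X} \<subseteq> Y" for Y
    using assms stone_set_inj by metis
  then show ?thesis by (simp add: A_obj_def)
qed

section \<open>The conditional evaluated at an ultrafilter\<close>

lemma Ult_cond_meet:
  assumes "X \<in> Ult C" "a \<in> car C" "c \<in> car C" "d \<in> car C"
  shows "a \<box>\<rightarrow> (c \<sqinter> d) \<in> X \<longleftrightarrow> a \<box>\<rightarrow> c \<in> X \<and> a \<box>\<rightarrow> d \<in> X"
  using assms by (simp add: cond_meet Ult_meet cond_closed)

lemma Ult_cond_mono:
  assumes "X \<in> Ult C" "a \<in> car C" "c \<in> car C" "d \<in> car C" "c \<sqsubseteq> d" "a \<box>\<rightarrow> c \<in> X"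
  shows "a \<box>\<rightarrow> d \<in> X"
  using Ult_cond_meet[OF assms(1-4)] assms by (simp add: vle_def)

text \<open>The set of \<open>c\<close> with \<open>a \<box>\<rightarrow> c \<in> X\<close> contains
  \<open>a\<close> by reflexivity, and is meet-closed and upward closed by \<open>cond_meet\<close>.
  If it omits \<open>b\<close>, none of its elements is below \<open>b\<close>, and
  \<open>Ult_separates\<close> yields a selected ultrafilter without \<open>b\<close>.\<close>

lemma sel_A_obj_subset_iff:
  assumes X: "X \<in> Ult C" and a: "a \<in> car C" and b: "b \<in> car C"
  shows "sel (A_obj C) (stone_set C a) X \<subseteq> stone_set C b \<longleftrightarrow> a \<box>\<rightarrow> b \<in> X"
proof
  assume sub: "sel (A_obj C) (stone_set C a) X \<subseteq> stone_set C b"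
  show "a \<box>\<rightarrow> b \<in> X"
  proof (rule ccontr)
    assume n: "a \<box>\<rightarrow> b \<notin> X"
    have "\<exists>U\<in>Ult C. {c \<in> car C. a \<box>\<rightarrow> c \<in> X} \<subseteq> U \<and> b \<notin> U"
    proof (rule Ult_separates)
      have "a \<in> {c \<in> car C. a \<box>\<rightarrow> c \<in> X}" using X a by (simp add: cond_refl Ult_unit)
      then show "{c \<in> car C. a \<box>\<rightarrow> c \<in> X} \<noteq> {}" by blast
    qed (use X a b n in \<open>auto simp: Ult_cond_meet meet_closed intro: Ult_cond_mono\<close>)
    then show False using sub unfolding sel_A_obj[OF a] by (auto simp: stone_set_def[of C b])
  qed
qed (use assms in \<open>auto simp: sel_A_obj stone_set_def[of C b]\<close>)

lemma stone_set_cond: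
  assumes "a \<in> car C" "b \<in> car C"
  shows "stone_set C (a \<box>\<rightarrow> b) = {X \<in> Ult C. sel (A_obj C) (stone_set C a) X \<subseteq> stone_set C b}"
  using assms sel_A_obj_subset_iff unfolding stone_set_def[of C "a \<box>\<rightarrow> b"] by blast

lemma Ult_cond_cong:
  assumes X: "X \<in> Ult C" and ab: "a \<in> car C" "b \<in> car C" "a \<box>\<rightarrow> b \<in> X" "b \<box>\<rightarrow> a \<in> X" and z: "z \<in> car C"
  shows "a \<box>\<rightarrow> z \<in> X \<longleftrightarrow> b \<box>\<rightarrow> z \<in> X"
proof -
  have "(a \<box>\<rightarrow> b) \<sqinter> (b \<box>\<rightarrow> a) \<in> X" using X ab by (intro Ult_meetI)
  then have "((a \<box>\<rightarrow> z) \<leftrightarrow> (b \<box>\<rightarrow> z)) \<in> X"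
    using Ult_up[OF X _ _ cond_cong[OF ab(1,2) z]] ab z by (simp add: biimp_closed cond_closed)
  then show ?thesis using X ab z by (simp add: Ult_biimp cond_closed)
qed

text \<open>By primeness \<open>X\<close> contains one of the three joinands of
  \<open>cond_join\<close>; the hypotheses \<open>n\<close> leave only the biimplication.\<close>

lemma Ult_cond_join:
  assumes X: "X \<in> Ult C" and ab: "a \<in> car C" "b \<in> car C" and z: "z \<in> car C"
    and n: "(a \<squnion> b) \<box>\<rightarrow> a \<notin> X" "(a \<squnion> b) \<box>\<rightarrow> b \<notin> X"
  shows "(a \<squnion> b) \<box>\<rightarrow> z \<in> X \<longleftrightarrow> a \<box>\<rightarrow> z \<in> X \<and> b \<box>\<rightarrow> z \<in> X"
proof -
  have "((a \<squnion> b) \<box>\<rightarrow> a) \<squnion> ((a \<squnion> b) \<box>\<rightarrow> b)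
                \<squnion> (((a \<squnion> b) \<box>\<rightarrow> z) \<leftrightarrow> ((a \<box>\<rightarrow> z) \<sqinter> (b \<box>\<rightarrow> z))) \<in> X"
    using X ab z by (simp add: cond_join Ult_unit)
  then show ?thesis
    using X ab z n by (simp add: Ult_join Ult_biimp Ult_meet cond_closed join_closed biimp_closed meet_closed)
qed

text \<open>Via \<open>sel_A_obj_subset_iff\<close>, (\<alpha>1) comes from
  \<open>cond_refl\<close>, (\<alpha>2) from \<open>cond_cong\<close>, (\<alpha>3) from
  \<open>cond_join\<close> and (\<alpha>4) from closure under the conditional. For (\<alpha>5) the
  selected set is an intersection of clopens.\<close>

lemma alpha_model_A_obj: "alpha_model (A_obj C)"
proof
  show "stone_space (topo (A_obj C))" by (rule stone_space_A_obj)
next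
  fix A X assume "A \<in> Cl (A_obj C)" "X \<in> pts (A_obj C)"
  then obtain a where "a \<in> car C" "A = stone_set C a" "X \<in> Ult C"
    by (auto simp: clopens_A_obj pts_A_obj)
  then show "sel (A_obj C) A X \<subseteq> A"
    by (simp add: sel_A_obj_subset_iff cond_refl Ult_unit)
next
  fix A B X assume AB: "A \<in> Cl (A_obj C)" "B \<in> Cl (A_obj C)" "X \<in> pts (A_obj C)"
    "sel (A_obj C) A X \<subseteq> B" "sel (A_obj C) B X \<subseteq> A"
  show "sel (A_obj C) A X = sel (A_obj C) B X"
  proof -
    obtain a b where ab: "a \<in> car C" "A = stone_set C a" "b \<in> car C" "B = stone_set C b"
      using AB(1,2) by (auto simp: clopens_A_obj)
    have X: "X \<in> Ult C" using AB(3) by (simp add: pts_A_obj)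
    have "a \<box>\<rightarrow> b \<in> X" "b \<box>\<rightarrow> a \<in> X"
      using AB(4,5) sel_A_obj_subset_iff[OF X ab(1,3)] sel_A_obj_subset_iff[OF X ab(3,1)]
      unfolding ab(2,4) by blast+
    then have "{c \<in> car C. a \<box>\<rightarrow> c \<in> X} = {c \<in> car C. b \<box>\<rightarrow> c \<in> X}"
      using Ult_cond_cong[OF X ab(1,3)] by blast
    then show ?thesis unfolding ab(2,4) sel_A_obj[OF ab(1)] sel_A_obj[OF ab(3)] by (rule arg_cong)
  qed
next
  fix A B X assume "A \<in> Cl (A_obj C)" "B \<in> Cl (A_obj C)" and X': "X \<in> pts (A_obj C)"
  then obtain a b where ab: "a \<in> car C" "b \<in> car C" and A: "A = stone_set C a" and B: "B = stone_set C b"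
    by (auto simp: clopens_A_obj)
  have X: "X \<in> Ult C" using X' by (simp add: pts_A_obj)
  have AB: "A \<union> B = stone_set C (a \<squnion> b)" using ab by (simp add: stone_set_join A B)
  have "sel (A_obj C) (A \<union> B) X = sel (A_obj C) A X \<union> sel (A_obj C) B X"
    if "(a \<squnion> b) \<box>\<rightarrow> a \<notin> X" "(a \<squnion> b) \<box>\<rightarrow> b \<notin> X"
  proof -
    define F where "F = {c \<in> car C. a \<box>\<rightarrow> c \<in> X}"
    define G where "G = {c \<in> car C. b \<box>\<rightarrow> c \<in> X}"
    \<comment> \<open>An intersection of two filters lies in a prime filter only if one of them
      does: for witnesses \<open>c\<close> and \<open>d\<close> outside \<open>Y\<close>, the join
      \<open>c \<squnion> d\<close> is in both filters but not in \<open>Y\<close>.\<close>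
    have "F \<inter> G \<subseteq> Y \<longleftrightarrow> F \<subseteq> Y \<or> G \<subseteq> Y" if Y: "Y \<in> Ult C" for Y
    proof (intro iffI, rule ccontr)
      assume sub: "F \<inter> G \<subseteq> Y" and "\<not> (F \<subseteq> Y \<or> G \<subseteq> Y)"
      then obtain c d where cd: "c \<in> F" "c \<notin> Y" "d \<in> G" "d \<notin> Y"
        by blast
      then have car: "c \<in> car C" "d \<in> car C" by (auto simp: F_def G_def)
      have "c \<squnion> d \<in> F"
        using cd Ult_cond_mono[OF X ab(1) _ _ le_join1[OF car]] car by (simp add: F_def join_closed)
      moreover have "c \<squnion> d \<in> G"
        using cd Ult_cond_mono[OF X ab(2) _ _ le_join2[OF car]] car by (simp add: G_def join_closed)
      ultimately show False using sub cd car Ult_join[OF Y] by blast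
    qed blast
    then have "{Y \<in> Ult C. F \<inter> G \<subseteq> Y} = {Y \<in> Ult C. F \<subseteq> Y} \<union> {Y \<in> Ult C. G \<subseteq> Y}"
      by blast
    moreover have "{c \<in> car C. (a \<squnion> b) \<box>\<rightarrow> c \<in> X} = F \<inter> G"
      using Ult_cond_join[OF X ab _ that] by (auto simp: F_def G_def)
    ultimately show ?thesis
      unfolding AB unfolding A B sel_A_obj[OF ab(1)] sel_A_obj[OF ab(2)] sel_A_obj[OF join_closed[OF ab]]
      by (simp add: F_def G_def)
  qed
  then show "sel (A_obj C) (A \<union> B) X \<subseteq> A \<or> sel (A_obj C) (A \<union> B) X \<subseteq> B \<or>
      sel (A_obj C) (A \<union> B) X = sel (A_obj C) A X \<union> sel (A_obj C) B X"
    using sel_A_obj_subset_iff[OF X join_closed[OF ab] ab(1)] sel_A_obj_subset_iff[OF X join_closed[OF ab] ab(2)]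
    unfolding AB unfolding A B by blast
next
  fix A B assume "A \<in> Cl (A_obj C)" "B \<in> Cl (A_obj C)"
  then show "{X \<in> pts (A_obj C). sel (A_obj C) A X \<subseteq> B} \<in> Cl (A_obj C)"
    by (auto simp: clopens_A_obj pts_A_obj stone_set_cond[symmetric] cond_closed)
next
  fix A X assume "A \<in> Cl (A_obj C)" "X \<in> pts (A_obj C)"
  then obtain a where a: "a \<in> car C" "A = stone_set C a" and X: "X \<in> Ult C"
    by (auto simp: clopens_A_obj pts_A_obj)
  \<comment> \<open>A nonempty index set is essential: the intersection of the empty family would be
    the whole type instead of \<open>Ult C\<close>.\<close>
  have aF: "a \<in> {c \<in> car C. a \<box>\<rightarrow> c \<in> X}"
    using a X by (simp add: cond_refl Ult_unit)
  have "sel (A_obj C) A X = \<Inter>(stone_set C ` {c \<in> car C. a \<box>\<rightarrow> c \<in> X})"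
    unfolding a(2) sel_A_obj[OF a(1)] using aF by (auto simp: stone_set_def)
  moreover have "closedin (topo (A_obj C)) \<dots>"
  proof (rule closedin_Inter)
    show "stone_set C ` {c \<in> car C. a \<box>\<rightarrow> c \<in> X} \<noteq> {}"
      using aF by blast
    have "stone_set C c \<in> Cl (A_obj C)" if "c \<in> car C" for c
      using that clopens_A_obj by blast
    then show "closedin (topo (A_obj C)) K" if "K \<in> stone_set C ` {c \<in> car C. a \<box>\<rightarrow> c \<in> X}" for K
      using that by (auto simp: clopens_def)
  qed
  ultimately show "closedin (topo (A_obj C)) (sel (A_obj C) A X)" by simp
qed

lemma A_obj_TAM: "A_obj C \<in> TAM"
  by (simp add: TAM_def alpha_model_A_obj)

end

section \<open>The action on homomorphisms\<close>

lemma V_homD: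
  assumes "h \<in> V_hom C D"
  shows "x \<in> car C \<Longrightarrow> h x \<in> car D"
    and "h \<in> extensional (car C)"
    and "\<lbrakk>x \<in> car C; y \<in> car C\<rbrakk> \<Longrightarrow> h (x \<sqinter>\<^bsub>C\<^esub> y) = h x \<sqinter>\<^bsub>D\<^esub> h y"
    and "\<lbrakk>x \<in> car C; y \<in> car C\<rbrakk> \<Longrightarrow> h (x \<squnion>\<^bsub>C\<^esub> y) = h x \<squnion>\<^bsub>D\<^esub> h y"
    and "\<lbrakk>x \<in> car C; y \<in> car C\<rbrakk> \<Longrightarrow> h (x \<leadsto>\<^bsub>C\<^esub> y) = h x \<leadsto>\<^bsub>D\<^esub> h y"
    and "\<lbrakk>x \<in> car C; y \<in> car C\<rbrakk> \<Longrightarrow> h (x \<box>\<rightarrow>\<^bsub>C\<^esub> y) = h x \<box>\<rightarrow>\<^bsub>D\<^esub> h y"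
    and "h \<zero>\<^bsub>C\<^esub> = \<zero>\<^bsub>D\<^esub>" and "h \<one>\<^bsub>C\<^esub> = \<one>\<^bsub>D\<^esub>"
  using assms by (simp_all add: V_hom_def PiE_iff)

lemma VAlgD: "C \<in> VAlg \<Longrightarrow> V_algebra C" "C \<in> VAlg \<Longrightarrow> Boolean_alg C"
  by (auto simp: VAlg_def V_algebra_def)

text \<open>Maximality transfers through \<open>UltI\<close>, because \<open>h\<close> preserves
  complements and \<open>U\<close> decides each \<open>h x\<close>.\<close>

lemma V_hom_preimage_Ult:
  assumes C: "C \<in> VAlg" and D: "D \<in> VAlg" and h: "h \<in> V_hom C D" and U: "U \<in> Ult D"
  shows "{a \<in> car C. h a \<in> U} \<in> Ult C"
proof -
  interpret C: V_algebra C by (rule VAlgD[OF C])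
  interpret D: V_algebra D by (rule VAlgD[OF D])
  note hD = V_homD[OF h]
  show ?thesis
  proof (rule C.UltI)
    show "proper_filter C {a \<in> car C. h a \<in> U}"
      unfolding proper_filter_def
    proof (intro conjI ballI impI)
      fix x y assume x: "x \<in> {a \<in> car C. h a \<in> U}" and y: "y \<in> car C" "x \<sqsubseteq>\<^bsub>C\<^esub> y"
      then have "h x \<sqsubseteq>\<^bsub>D\<^esub> h y" using hD(3)[of x y] by (simp add: vle_def)
      then show "y \<in> {a \<in> car C. h a \<in> U}" using x y D.Ult_up[OF U, of "h x" "h y"] hD(1) by simp
    qed (use U hD in \<open>auto simp: C.unit_closed D.Ult_unit D.Ult_zero C.meet_closed D.Ult_meet\<close>)
  next
    fix x assume "x \<in> car C"
    then show "x \<in> {a \<in> car C. h a \<in> U} \<or> x \<leadsto>\<^bsub>C\<^esub> \<zero>\<^bsub>C\<^esub> \<in> {a \<in> car C. h a \<in> U}"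
      using U hD by (auto simp: C.compl_closed C.zero_closed D.Ult_compl)
  qed
qed

text \<open>This carries continuity, the translation of antecedents in both morphism conditions, and
  naturality of \<open>eta\<close>.\<close>

lemma preimg_A_map:
  assumes "C \<in> VAlg" "D \<in> VAlg" "h \<in> V_hom C D" "a \<in> car C"
  shows "preimg (A_obj D) (A_map C D h) (stone_set C a) = stone_set D (h a)"
  using assms V_hom_preimage_Ult[OF assms(1-3)]
  by (auto simp: preimg_def Boolean_alg.pts_A_obj[OF VAlgD(2)] A_map_def stone_set_def)

lemma A_map_hom:
  assumes C: "C \<in> VAlg" and D: "D \<in> VAlg" and h: "h \<in> V_hom C D"
  shows "A_map C D h \<in> alpha_hom (A_obj D) (A_obj C)"
proof -
  interpret C: V_algebra C by (rule VAlgD[OF C])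
  interpret D: V_algebra D by (rule VAlgD[OF D])
  note hD = V_homD[OF h]
  let ?\<phi> = "A_map C D h"
  have app: "?\<phi> U = {a \<in> car C. h a \<in> U}" "?\<phi> U \<in> Ult C" if "U \<in> Ult D" for U
    using that V_hom_preimage_Ult[OF C D h] by (auto simp: A_map_def)
  have cont: "continuous_map (topo (A_obj D)) (topo (A_obj C)) ?\<phi>"
    unfolding continuous_map_def C.pts_A_obj D.pts_A_obj
  proof (intro conjI allI impI)
    show "?\<phi> \<in> Ult D \<rightarrow> Ult C" using app by blast
    fix W assume W: "openin (topo (A_obj C)) W"
    show "openin (topo (A_obj D)) {U \<in> Ult D. ?\<phi> U \<in> W}"
    proof (subst openin_subopen, intro ballI)
      fix U assume "U \<in> {U \<in> Ult D. ?\<phi> U \<in> W}"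
      then have U: "U \<in> Ult D" "?\<phi> U \<in> W" by auto
      then obtain a where a: "a \<in> car C" "?\<phi> U \<in> stone_set C a" "stone_set C a \<subseteq> W"
        using C.openin_A_obj_base[OF W] by blast
      have "stone_set D (h a) = {U \<in> Ult D. ?\<phi> U \<in> stone_set C a}"
        using preimg_A_map[OF C D h a(1)] by (simp add: preimg_def D.pts_A_obj)
      then show "\<exists>T. openin (topo (A_obj D)) T \<and> U \<in> T \<and> T \<subseteq> {U \<in> Ult D. ?\<phi> U \<in> W}"
        using D.openin_stone_set[OF hD(1)[OF a(1)]] U a by auto
    qed
  qed
  have lift: "\<exists>Y. ?\<phi> Y = Y' \<and> Y \<in> sel (A_obj D) (stone_set D (h a)) U"
    if a: "a \<in> car C" and U: "U \<in> Ult D" and Y': "Y' \<in> sel (A_obj C) (stone_set C a) (?\<phi> U)" for a U Y'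
  proof -
    have Y'u: "Y' \<in> Ult C" and Y's: "\<And>c. \<lbrakk>c \<in> car C; h (a \<box>\<rightarrow>\<^bsub>C\<^esub> c) \<in> U\<rbrakk> \<Longrightarrow> c \<in> Y'"
      using Y' a U by (auto simp: C.sel_A_obj app C.cond_closed)
    let ?F = "{d \<in> car D. h a \<box>\<rightarrow>\<^bsub>D\<^esub> d \<in> U}"
    \<comment> \<open>Containing \<open>?F\<close> makes \<open>Y\<close> selected at
      \<open>U\<close>; containing the image of \<open>Y'\<close> makes its pullback contain
      \<open>Y'\<close>, hence equal it by maximality.\<close>
    have "\<exists>Y\<in>Ult D. ?F \<subseteq> Y \<and> h ` Y' \<subseteq> Y"
    proof (rule D.ultrafilter_extends)
      show "h ` Y' \<subseteq> car D" using hD(1) C.Ult_car[OF Y'u] by blast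
      show "h ` Y' \<noteq> {}" using C.Ult_unit[OF Y'u] by blast
      have "h a \<in> ?F" using a U hD(1) by (simp add: D.cond_refl D.Ult_unit)
      then show "?F \<noteq> {}" by blast
      show "x \<sqinter>\<^bsub>D\<^esub> y \<in> ?F" if "x \<in> ?F" "y \<in> ?F" for x y
        using that U a hD(1) by (simp add: D.meet_closed D.Ult_cond_meet)
      show "x \<sqinter>\<^bsub>D\<^esub> y \<in> h ` Y'" if xy: "x \<in> h ` Y'" "y \<in> h ` Y'" for x y
      proof -
        obtain u v where "x = h u" "u \<in> Y'" "y = h v" "v \<in> Y'" using xy by blast
        moreover from this have "h (u \<sqinter>\<^bsub>C\<^esub> v) = x \<sqinter>\<^bsub>D\<^esub> y"
          using C.Ult_car[OF Y'u] by (simp add: hD(3))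
        ultimately show ?thesis using C.Ult_meetI[OF Y'u] by (metis imageI)
      qed
      show "x \<sqinter>\<^bsub>D\<^esub> y \<noteq> \<zero>\<^bsub>D\<^esub>" if x: "x \<in> ?F" and y: "y \<in> h ` Y'" for x y
      proof
        \<comment> \<open>Disjointness puts \<open>x\<close> below the complement of
          \<open>h u\<close>, so the conditional from \<open>h a\<close> to that complement is in
          \<open>U\<close>. As \<open>h\<close> preserves it, the complement of \<open>u\<close>
          lies in \<open>Y'\<close>, together with \<open>u\<close>.\<close>
        assume xy: "x \<sqinter>\<^bsub>D\<^esub> y = \<zero>\<^bsub>D\<^esub>"
        obtain u where u: "u \<in> Y'" "y = h u" "u \<in> car C" using y C.Ult_car[OF Y'u] by blast
        have nu: "u \<leadsto>\<^bsub>C\<^esub> \<zero>\<^bsub>C\<^esub> \<in> car C" "h (u \<leadsto>\<^bsub>C\<^esub> \<zero>\<^bsub>C\<^esub>) = y \<leadsto>\<^bsub>D\<^esub> \<zero>\<^bsub>D\<^esub>"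
          using u hD by (simp_all add: C.compl_closed C.zero_closed)
        have yD: "y \<in> car D" using u hD(1) by simp
        have "x \<sqsubseteq>\<^bsub>D\<^esub> y \<leadsto>\<^bsub>D\<^esub> \<zero>\<^bsub>D\<^esub>"
        proof -
          have "stone_set D x \<inter> stone_set D y = {}"
            using D.stone_set_meet[of x y] D.stone_set_zero x yD xy by simp
          moreover have "stone_set D x \<subseteq> Ult D" by (auto simp: stone_set_def)
          ultimately have "stone_set D x \<subseteq> stone_set D (y \<leadsto>\<^bsub>D\<^esub> \<zero>\<^bsub>D\<^esub>)"
            unfolding D.stone_set_compl[OF yD] by blast
          then show ?thesis using x yD by (simp add: D.stone_set_subset_iff D.compl_closed)
        qed
        then have "h a \<box>\<rightarrow>\<^bsub>D\<^esub> h (u \<leadsto>\<^bsub>C\<^esub> \<zero>\<^bsub>C\<^esub>) \<in> U"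
          using D.Ult_cond_mono[OF U hD(1)[OF a], of x "y \<leadsto>\<^bsub>D\<^esub> \<zero>\<^bsub>D\<^esub>"] x yD nu by (simp add: D.compl_closed)
        then have "u \<leadsto>\<^bsub>C\<^esub> \<zero>\<^bsub>C\<^esub> \<in> Y'" using Y's nu(1) a hD(6) by metis
        then show False using u C.Ult_compl[OF Y'u] by blast
      qed
    qed auto
    then obtain Y where Y: "Y \<in> Ult D" "?F \<subseteq> Y" "h ` Y' \<subseteq> Y" by blast
    have "Y' \<subseteq> ?\<phi> Y" using Y C.Ult_car[OF Y'u] by (auto simp: app)
    then have "?\<phi> Y = Y'" using C.Ult_maximal[OF Y'u] app(2) Y by blast
    then show ?thesis using Y hD(1)[OF a] by (auto simp: D.sel_A_obj)
  qed
  have "?\<phi> Y \<in> sel (A_obj C) (stone_set C a) (?\<phi> U)"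
    if "a \<in> car C" "U \<in> Ult D" "Y \<in> sel (A_obj D) (stone_set D (h a)) U" for a U Y
    using that hD(1,6) app by (auto simp: C.sel_A_obj D.sel_A_obj C.cond_closed)
  with lift show ?thesis
    using cont unfolding alpha_hom_def mem_Collect_eq C.clopens_A_obj D.pts_A_obj ball_simps
    by (simp add: preimg_A_map[OF C D h]) (simp add: A_map_def)
qed

lemma A_map_id:
  assumes "C \<in> VAlg"
  shows "A_map C C (V_id C) = alpha_id (A_obj C)"
proof -
  interpret V_algebra C by (rule VAlgD[OF assms])
  have "{a \<in> car C. V_id C a \<in> U} = U" if "U \<in> Ult C" for U
    using Ult_car[OF that] by (auto simp: V_id_def)
  then show ?thesis
    unfolding A_map_def alpha_id_def pts_A_obj by (intro restrict_ext) simp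
qed

lemma A_map_comp:
  assumes "C \<in> VAlg" "D \<in> VAlg" "E \<in> VAlg" "h \<in> V_hom C D" "g \<in> V_hom D E"
  shows "A_map C E (V_comp C g h) = alpha_comp (A_obj E) (A_map C D h) (A_map D E g)"
  unfolding A_map_def alpha_comp_def compose_def V_comp_def Boolean_alg.pts_A_obj[OF VAlgD(2)[OF assms(3)]]
  by (rule restrict_ext)
    (use assms V_homD(1)[OF assms(4)] V_hom_preimage_Ult[OF assms(2,3,5)] in auto)


section \<open>From topological alpha-models to V-algebras\<close>

lemma clopens_subset: "A \<in> Cl S \<Longrightarrow> A \<subseteq> pts S"
  by (auto simp: clopens_def dest: openin_subset)

lemma clopens_closed:
  assumes "A \<in> Cl S" "B \<in> Cl S"
  shows "A \<inter> B \<in> Cl S" "A \<union> B \<in> Cl S" "pts S - A \<in> Cl S"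
  using assms by (auto simp: clopens_def)

lemma clopens_trivial: "{} \<in> Cl S" "pts S \<in> Cl S"
  by (auto simp: clopens_def)

lemma C_obj_simps [simp]:
  "car (C_obj S) = Cl S" "A \<sqinter>\<^bsub>C_obj S\<^esub> B = A \<inter> B" "A \<squnion>\<^bsub>C_obj S\<^esub> B = A \<union> B"
  "A \<leadsto>\<^bsub>C_obj S\<^esub> B = (pts S - A) \<union> B" "\<zero>\<^bsub>C_obj S\<^esub> = {}" "\<one>\<^bsub>C_obj S\<^esub> = pts S"
  "A \<box>\<rightarrow>\<^bsub>C_obj S\<^esub> B = {x \<in> pts S. sel S A x \<subseteq> B}"
  by (simp_all add: C_obj_def)

text \<open>The conditions on the model match the axioms: (\<alpha>4) gives closure, (\<alpha>1)
  reflexivity, (\<alpha>2) \<open>cond_cong\<close> and (\<alpha>3) \<open>cond_join\<close>. The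
  law \<open>cond_meet\<close> is inclusion in an intersection.\<close>

lemma C_obj_VAlg:
  assumes "S \<in> TAM"
  shows "C_obj S \<in> VAlg"
proof -
  interpret alpha_model S using assms by (simp add: TAM_def)
  have "V_algebra (C_obj S)"
  proof (unfold_locales, unfold C_obj_simps vle_def vbiimp_def)
    fix A B assume "A \<in> Cl S" "B \<in> Cl S"
    then show "pts S - A \<union> B \<in> Cl S" by (simp add: clopens_closed)
  next
    fix A B D assume AB: "A \<in> Cl S" "B \<in> Cl S" "D \<in> Cl S"
    have "sel S A x \<subseteq> D \<longleftrightarrow> sel S B x \<subseteq> D"
      if "x \<in> pts S" "sel S A x \<subseteq> B" "sel S B x \<subseteq> A" for x
      using alpha2[OF AB(1,2) that] by simp
    then show "{x \<in> pts S. sel S A x \<subseteq> B} \<inter> {x \<in> pts S. sel S B x \<subseteq> A} \<inter>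
       ((pts S - {x \<in> pts S. sel S A x \<subseteq> D} \<union> {x \<in> pts S. sel S B x \<subseteq> D}) \<inter>
        (pts S - {x \<in> pts S. sel S B x \<subseteq> D} \<union> {x \<in> pts S. sel S A x \<subseteq> D})) =
       {x \<in> pts S. sel S A x \<subseteq> B} \<inter> {x \<in> pts S. sel S B x \<subseteq> A}"
      by blast
    show "{x \<in> pts S. sel S (A \<union> B) x \<subseteq> A} \<union> {x \<in> pts S. sel S (A \<union> B) x \<subseteq> B} \<union>
       (pts S - {x \<in> pts S. sel S (A \<union> B) x \<subseteq> D} \<union>
        {x \<in> pts S. sel S A x \<subseteq> D} \<inter> {x \<in> pts S. sel S B x \<subseteq> D}) \<inter>
       (pts S - {x \<in> pts S. sel S A x \<subseteq> D} \<inter> {x \<in> pts S. sel S B x \<subseteq> D} \<union>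
        {x \<in> pts S. sel S (A \<union> B) x \<subseteq> D}) = pts S" (is "?L = _")
    proof (intro subset_antisym subsetI)
      show "x \<in> ?L" if "x \<in> pts S" for x
        using alpha3[OF AB(1,2) that] that by (elim disjE) simp_all
    qed auto
  qed (auto simp: clopens_closed clopens_trivial alpha4 dest: subsetD[OF clopens_subset] subsetD[OF alpha1])
  then show ?thesis by (simp add: VAlg_def)
qed

section \<open>The action on \<alpha>-morphisms\<close>

lemma alpha_homD:
  assumes "\<phi> \<in> alpha_hom S T"
  shows "\<phi> \<in> extensional (pts S)" "continuous_map (topo S) (topo T) \<phi>"
    and "x \<in> pts S \<Longrightarrow> \<phi> x \<in> pts T"
    and "\<lbrakk>A \<in> Cl T; x \<in> pts S; y \<in> sel S (preimg S \<phi> A) x\<rbrakk> \<Longrightarrow> \<phi> y \<in> sel T A (\<phi> x)"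
    and "\<lbrakk>A \<in> Cl T; x \<in> pts S; y' \<in> sel T A (\<phi> x)\<rbrakk>
          \<Longrightarrow> \<exists>y\<in>sel S (preimg S \<phi> A) x. \<phi> y = y'"
  using assms unfolding alpha_hom_def mem_Collect_eq continuous_map_def by blast+

lemma sel_subset_pts:
  assumes "S \<in> TAM" "A \<in> Cl S" "x \<in> pts S"
  shows "sel S A x \<subseteq> pts S"
  using assms alpha_model.alpha1[of S A x] clopens_subset by (fastforce simp: TAM_def)

lemma C_map_hom:
  assumes S: "S \<in> TAM" and T: "T \<in> TAM" and \<phi>: "\<phi> \<in> alpha_hom S T"
  shows "C_map S T \<phi> \<in> V_hom (C_obj T) (C_obj S)"
proof -
  interpret T: alpha_model T using T by (simp add: TAM_def)
  note \<phi>D = alpha_homD[OF \<phi>]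
  \<comment> \<open>Left to right uses that \<phi> maps selected points to selected points, right to
    left that selected points lift.\<close>
  have cond: "preimg S \<phi> {x \<in> pts T. sel T A x \<subseteq> B} = {x \<in> pts S. sel S (preimg S \<phi> A) x \<subseteq> preimg S \<phi> B}"
    if A: "A \<in> Cl T" and B: "B \<in> Cl T" for A B
  proof -
    have "sel T A (\<phi> x) \<subseteq> B \<longleftrightarrow> sel S (preimg S \<phi> A) x \<subseteq> preimg S \<phi> B" if x: "x \<in> pts S" for x
      using \<phi>D(4,5)[OF A x] sel_subset_pts[OF S preimg_clopen[OF \<phi> A] x]
      unfolding preimg_def[of S \<phi> B] by blast
    then show ?thesis using \<phi>D(3) by (auto simp: preimg_def[of S \<phi> "{x \<in> pts T. sel T A x \<subseteq> B}"])
  qed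
  have "C_map S T \<phi> \<in> Cl T \<rightarrow>\<^sub>E Cl S"
    using preimg_clopen[OF \<phi>] by (auto simp: C_map_def)
  moreover have "C_map S T \<phi> A = preimg S \<phi> A" if "A \<in> Cl T" for A
    using that by (simp add: C_map_def)
  moreover have "preimg S \<phi> (A \<inter> B) = preimg S \<phi> A \<inter> preimg S \<phi> B"
    "preimg S \<phi> (A \<union> B) = preimg S \<phi> A \<union> preimg S \<phi> B"
    "preimg S \<phi> (pts T - A \<union> B) = pts S - preimg S \<phi> A \<union> preimg S \<phi> B"
    "preimg S \<phi> {} = {}" "preimg S \<phi> (pts T) = pts S" for A B
    using \<phi>D(3) by (auto simp: preimg_def)
  ultimately show ?thesis
    using cond unfolding V_hom_def mem_Collect_eq C_obj_simps
    by (simp add: clopens_closed clopens_trivial T.alpha4)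
qed

lemma C_map_id: "C_map S S (alpha_id S) = V_id (C_obj S)"
proof -
  have "preimg S (alpha_id S) A = A" if "A \<in> Cl S" for A
    using clopens_subset[OF that] by (auto simp: preimg_def alpha_id_def)
  then show ?thesis
    unfolding C_map_def V_id_def C_obj_simps by (intro restrict_ext) simp
qed

lemma C_map_comp:
  assumes "\<phi> \<in> alpha_hom S T" "\<psi> \<in> alpha_hom T U"
  shows "C_map S U (alpha_comp S \<psi> \<phi>) = V_comp (C_obj U) (C_map S T \<phi>) (C_map T U \<psi>)"
  unfolding C_map_def V_comp_def compose_def C_obj_simps
  by (rule restrict_ext)
    (use preimg_clopen[OF assms(2)] alpha_homD(3)[OF assms(1)] in
      \<open>auto simp: preimg_def alpha_comp_def compose_def\<close>)


section \<open>The unit\<close>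

text \<open>Every element of \<open>D\<close> has the form \<open>h u\<close>, so the inverse
  inherits preservation of each operation. It is restricted to \<open>car D\<close> because
  morphisms are extensional.\<close>

lemma V_isoI:
  assumes C: "C \<in> VAlg" and h: "h \<in> V_hom C D" and bij: "bij_betw h (car C) (car D)"
  shows "h \<in> V_iso C D"
proof -
  interpret V_algebra C by (rule VAlgD[OF C])
  note hD = V_homD[OF h]
  define g where "g = restrict (inv_into (car C) h) (car D)"
  have g_ext: "g \<in> extensional (car D)" by (simp add: g_def)
  have gh: "g (h x) = x" if "x \<in> car C" for x
    using bij hD(1)[OF that] that by (simp add: g_def bij_betw_def)
  have surj: "\<exists>x\<in>car C. y = h x" if "y \<in> car D" for y
    using bij that by (auto simp: bij_betw_def)
  have g_car: "g y \<in> car C" and hg: "h (g y) = y" if "y \<in> car D" for y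
    using surj[OF that] gh by auto
  have gop: "g (h x) \<in> car C" "g (h (x \<sqinter>\<^bsub>C\<^esub> y)) = x \<sqinter>\<^bsub>C\<^esub> y" "g (h (x \<squnion>\<^bsub>C\<^esub> y)) = x \<squnion>\<^bsub>C\<^esub> y" "g (h (x \<leadsto>\<^bsub>C\<^esub> y)) = x \<leadsto>\<^bsub>C\<^esub> y"
    "g (h (x \<box>\<rightarrow>\<^bsub>C\<^esub> y)) = x \<box>\<rightarrow>\<^bsub>C\<^esub> y" if "x \<in> car C" "y \<in> car C" for x y
    using that by (simp_all add: gh meet_closed join_closed imp_closed cond_closed)
  have "g (y \<sqinter>\<^bsub>D\<^esub> z) = g y \<sqinter>\<^bsub>C\<^esub> g z \<and> g (y \<squnion>\<^bsub>D\<^esub> z) = g y \<squnion>\<^bsub>C\<^esub> g z \<and>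
      g (y \<leadsto>\<^bsub>D\<^esub> z) = g y \<leadsto>\<^bsub>C\<^esub> g z \<and> g (y \<box>\<rightarrow>\<^bsub>D\<^esub> z) = g y \<box>\<rightarrow>\<^bsub>C\<^esub> g z"
    if yz: "y \<in> car D" "z \<in> car D" for y z
  proof -
    obtain u v where uv: "u \<in> car C" "v \<in> car C" "y = h u" "z = h v"
      using surj yz by blast
    then show ?thesis using gop(2-5)[OF uv(1,2)] by (simp add: hD gh)
  qed
  moreover have "g \<zero>\<^bsub>D\<^esub> = \<zero>\<^bsub>C\<^esub>" "g \<one>\<^bsub>D\<^esub> = \<one>\<^bsub>C\<^esub>"
    using gh[OF zero_closed] gh[OF unit_closed] by (simp_all add: hD)
  ultimately have "g \<in> V_hom D C"
    using g_car g_ext unfolding V_hom_def PiE_iff by simp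
  moreover have "V_comp C g h = V_id C"
    unfolding V_comp_def V_id_def compose_def by (rule restrict_ext) (simp add: gh)
  moreover have "V_comp D h g = V_id D"
    unfolding V_comp_def V_id_def compose_def by (rule restrict_ext) (simp add: hg)
  ultimately show ?thesis using h by (auto simp: V_iso_def)
qed

text \<open>Stone representation: \<open>stone_set_inj\<close> gives injectivity,
  \<open>clopens_A_obj\<close> surjectivity, and \<open>stone_set_cond\<close> preservation of the
  conditional.\<close>

lemma eta_iso:
  assumes C: "C \<in> VAlg"
  shows "eta C \<in> V_iso C (C_obj (A_obj C))"
proof (rule V_isoI[OF C])
  interpret V_algebra C by (rule VAlgD[OF C])
  show "eta C \<in> V_hom C (C_obj (A_obj C))"
    unfolding V_hom_def mem_Collect_eq C_obj_simps pts_A_obj clopens_A_obj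
    by (auto simp: eta_def meet_closed join_closed imp_closed cond_closed zero_closed unit_closed
        stone_set_meet stone_set_join stone_set_imp stone_set_zero stone_set_unit stone_set_cond)
  show "bij_betw (eta C) (car C) (car (C_obj (A_obj C)))"
    by (auto simp: bij_betw_def inj_on_def eta_def clopens_A_obj stone_set_inj)
qed

lemma eta_natural:
  assumes "C \<in> VAlg" "D \<in> VAlg" "h \<in> V_hom C D"
  shows "V_comp C (C_map (A_obj D) (A_obj C) (A_map C D h)) (eta C) = V_comp C (eta D) h"
  unfolding V_comp_def compose_def
proof (rule restrict_ext)
  fix a assume a: "a \<in> car C"
  then have "stone_set C a \<in> Cl (A_obj C)"
    using Boolean_alg.clopens_A_obj[OF VAlgD(2)[OF assms(1)]] by blast
  then show "C_map (A_obj D) (A_obj C) (A_map C D h) (eta C a) = eta D (h a)"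
    using a preimg_A_map[OF assms a] V_homD(1)[OF assms(3) a] by (simp add: C_map_def eta_def)
qed


section \<open>The counit\<close>

text \<open>Pulling a clopen back along the inverse and then along \<phi> returns it, so the two
  morphism conditions exchange roles: lifting for \<phi> gives preservation for the inverse, and
  conversely.\<close>

lemma alpha_isoI:
  assumes S: "S \<in> TAM" and \<phi>: "\<phi> \<in> alpha_hom S T" and hom: "homeomorphic_map (topo S) (topo T) \<phi>"
  shows "\<phi> \<in> alpha_iso S T"
proof -
  note \<phi>D = alpha_homD[OF \<phi>]
  obtain g where g: "homeomorphic_maps (topo S) (topo T) \<phi> g"
    using hom homeomorphic_map_maps by blast
  define \<psi> where "\<psi> = restrict g (pts T)"
  have \<psi>\<phi>: "\<psi> (\<phi> x) = x" if "x \<in> pts S" for x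
    using g that \<phi>D(3)[OF that] by (simp add: \<psi>_def homeomorphic_maps_def)
  have \<phi>\<psi>: "\<phi> (\<psi> y) = y" if "y \<in> pts T" for y
    using g that by (simp add: \<psi>_def homeomorphic_maps_def)
  have cont: "continuous_map (topo T) (topo S) \<psi>"
    using g continuous_map_eq[of "topo T" "topo S" g \<psi>] by (simp add: \<psi>_def homeomorphic_maps_def)
  then have \<psi>_pts: "\<psi> y \<in> pts S" if "y \<in> pts T" for y
    using that by (auto simp: continuous_map_def)
  have pre: "preimg S \<phi> (preimg T \<psi> A) = A" if "A \<in> Cl S" for A
    using clopens_subset[OF that] \<phi>D(3) \<psi>\<phi> by (auto simp: preimg_def)
  have cl: "preimg T \<psi> A \<in> Cl T" if "A \<in> Cl S" for A
    using that cont unfolding clopens_def preimg_def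
    by (simp add: openin_continuous_map_preimage closedin_continuous_map_preimage)
  have "\<psi> y' \<in> sel S A (\<psi> x')" if A: "A \<in> Cl S" and x': "x' \<in> pts T" and y': "y' \<in> sel T (preimg T \<psi> A) x'"
    for A x' y'
  proof -
    obtain y where y: "y \<in> sel S A (\<psi> x')" "\<phi> y = y'"
      using \<phi>D(5)[OF cl[OF A] \<psi>_pts[OF x'], of y'] y' by (auto simp: pre[OF A] \<phi>\<psi>[OF x'])
    then show ?thesis using \<psi>\<phi> sel_subset_pts[OF S A \<psi>_pts[OF x']] by auto
  qed
  moreover have "\<exists>y'. \<psi> y' = y \<and> y' \<in> sel T (preimg T \<psi> A) x'"
    if A: "A \<in> Cl S" and x': "x' \<in> pts T" and y: "y \<in> sel S A (\<psi> x')" for A x' y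
    using \<phi>D(4)[OF cl[OF A] \<psi>_pts[OF x'], of y] y \<psi>\<phi> sel_subset_pts[OF S A \<psi>_pts[OF x']]
    by (intro exI[of _ "\<phi> y"]) (auto simp: pre[OF A] \<phi>\<psi>[OF x'])
  ultimately have "\<psi> \<in> alpha_hom T S"
    using cont by (auto simp: alpha_hom_def \<psi>_def)
  moreover have "alpha_comp S \<psi> \<phi> = alpha_id S"
    unfolding alpha_comp_def alpha_id_def compose_def by (rule restrict_ext) (simp add: \<psi>\<phi>)
  moreover have "alpha_comp T \<phi> \<psi> = alpha_id T"
    unfolding alpha_comp_def alpha_id_def compose_def by (rule restrict_ext) (simp add: \<phi>\<psi>)
  ultimately show ?thesis using \<phi> by (auto simp: alpha_iso_def)
qed

section \<open>Points as ultrafilters of clopens\<close>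

context alpha_model
begin

lemma TAM: "S \<in> TAM"
  by (simp add: TAM_def alpha_model_axioms)

lemma VAlg_C_obj: "C_obj S \<in> VAlg"
  by (rule C_obj_VAlg[OF TAM])

sublocale V: V_algebra "C_obj S"
  by (rule VAlgD[OF VAlg_C_obj])

text \<open>The clopen base applied to the complement of \<open>K\<close>; equivalently,
  \<open>K\<close> is the intersection of the clopens above it.\<close>

lemma clopen_separates_closed:
  assumes "closedin (topo S) K" "x \<in> pts S" "x \<notin> K"
  shows "\<exists>A\<in>Cl S. K \<subseteq> A \<and> x \<notin> A"
proof -
  have "openin (topo S) (pts S - K)" using assms by blast
  then obtain A where "A \<in> Cl S" "x \<in> A" "A \<subseteq> pts S - K"
    using stone assms unfolding stone_space_def by blast
  then show ?thesis
    using closedin_subset[OF assms(1)] clopens_closed(3)[of A S A] by (intro bexI[of _ "pts S - A"]) auto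
qed

lemma point_filter_Ult:
  assumes x: "x \<in> pts S"
  shows "{A \<in> Cl S. x \<in> A} \<in> Ult (C_obj S)"
proof (rule V.UltI)
  show "proper_filter (C_obj S) {A \<in> Cl S. x \<in> A}"
    using x by (auto simp: proper_filter_def vle_def clopens_trivial clopens_closed)
qed (use x clopens_closed in auto)

text \<open>Members of \<open>X\<close> are closed with the finite intersection property, so
  compactness supplies a common point. Its filter contains \<open>X\<close> and equals it by
  maximality.\<close>

lemma Ult_point_filter:
  assumes X: "X \<in> Ult (C_obj S)"
  shows "\<exists>x\<in>pts S. {A \<in> Cl S. x \<in> A} = X"
proof -
  have XCl: "A \<in> Cl S" if "A \<in> X" for A
    using V.Ult_car[OF X that] by simp
  have ptsX: "pts S \<in> X" using V.Ult_unit[OF X] by simp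
  \<comment> \<open>The factor \<open>pts S\<close> handles the empty family, whose intersection is
    the whole type.\<close>
  have fin: "\<Inter>\<F> \<inter> pts S \<in> X" if "finite \<F>" "\<F> \<subseteq> X" for \<F>
    using that
  proof (induction rule: finite_induct)
    case (insert A \<F>)
    then show ?case using V.Ult_meetI[OF X, of A "\<Inter>\<F> \<inter> pts S"] by (simp add: Int_assoc)
  qed (simp add: ptsX)
  have "\<Inter>X \<noteq> {}"
  proof -
    have "compact_space (topo S)" using stone by (simp add: stone_space_def)
    moreover have "\<forall>A\<in>X. closedin (topo S) A" using XCl by (auto simp: clopens_def)
    moreover have "\<forall>\<F>. finite \<F> \<and> \<F> \<subseteq> X \<longrightarrow> \<Inter>\<F> \<noteq> {}"
    proof (intro allI impI notI)
      fix \<F> assume "finite \<F> \<and> \<F> \<subseteq> X" "\<Inter>\<F> = {}"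
      then show False using fin[of \<F>] V.Ult_zero[OF X] by simp
    qed
    ultimately show ?thesis unfolding compact_space_fip by blast
  qed
  then obtain x where x: "x \<in> \<Inter>X" by blast
  then have "x \<in> pts S" using ptsX by blast
  moreover have "X \<subseteq> {A \<in> Cl S. x \<in> A}" using XCl x by blast
  ultimately show ?thesis using V.Ult_maximal[OF X point_filter_Ult] by blast
qed

lemma eps_stone_set:
  assumes "x \<in> pts S" "A \<in> Cl S"
  shows "eps S x \<in> stone_set (C_obj S) A \<longleftrightarrow> x \<in> A"
  using assms point_filter_Ult by (simp add: eps_def stone_set_def)

lemma preimg_eps: "A \<in> Cl S \<Longrightarrow> preimg S (eps S) (stone_set (C_obj S) A) = A"
  using eps_stone_set clopens_subset by (fastforce simp: preimg_def)

text \<open>A continuous bijection from a compact space to a Hausdorff space. Injectivity separates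
  a point from a closed singleton by a clopen.\<close>

lemma eps_homeomorphic: "homeomorphic_map (topo S) (topo (A_obj (C_obj S))) (eps S)"
proof (rule continuous_imp_homeomorphic_map)
  show "compact_space (topo S)" using stone by (simp add: stone_space_def)
  show "Hausdorff_space (topo (A_obj (C_obj S)))"
    using V.stone_space_A_obj by (simp add: stone_space_def)
  show "eps S ` pts S = pts (A_obj (C_obj S))"
    using point_filter_Ult Ult_point_filter by (force simp: V.pts_A_obj eps_def image_iff)
  show "inj_on (eps S) (pts S)"
  proof
    fix x y assume xy: "x \<in> pts S" "y \<in> pts S" "eps S x = eps S y"
    have K: "closedin (topo S) {y}"
      using stone xy(2) by (simp add: stone_space_def closedin_Hausdorff_sing_eq)
    show "x = y"
      using clopen_separates_closed[OF K xy(1)] eps_stone_set[OF xy(1)] eps_stone_set[OF xy(2)] xy(3) by auto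
  qed
  show "continuous_map (topo S) (topo (A_obj (C_obj S))) (eps S)"
  proof -
    have "openin (topo S) (eps S -` stone_set (C_obj S) A \<inter> pts S)" if "A \<in> Cl S" for A
    proof -
      have "eps S -` stone_set (C_obj S) A \<inter> pts S = A"
        using preimg_eps[OF that] by (auto simp: preimg_def)
      then show ?thesis using that by (simp add: clopens_def)
    qed
    moreover have "eps S ` pts S \<subseteq> \<Union>(stone_set (C_obj S) ` Cl S)"
      using eps_stone_set clopens_trivial by fastforce
    ultimately show ?thesis
      unfolding A_obj_def by (auto simp: continuous_on_generated_topo_iff)
  qed
qed

text \<open>As \<open>eps S\<close> maps onto the ultrafilters, both morphism conditions reduce to
  the equivalence \<open>sel\<close>.\<close>

lemma eps_hom: "eps S \<in> alpha_hom S (A_obj (C_obj S))"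
proof -
  have sel: "eps S y \<in> sel (A_obj (C_obj S)) (stone_set (C_obj S) A) (eps S x) \<longleftrightarrow> y \<in> sel S A x"
    if A: "A \<in> Cl S" and x: "x \<in> pts S" and y: "y \<in> pts S" for A x y
  proof -
    have "eps S y \<in> sel (A_obj (C_obj S)) (stone_set (C_obj S) A) (eps S x) \<longleftrightarrow>
        (\<forall>B\<in>Cl S. sel S A x \<subseteq> B \<longrightarrow> y \<in> B)"
      using x y A alpha4[OF A] point_filter_Ult[OF y]
      by (subst V.sel_A_obj) (auto simp: eps_def)
    \<comment> \<open>Here (\<alpha>5) enters: the selected set is closed, so clopen supersets
      determine it.\<close>
    also have "\<dots> \<longleftrightarrow> y \<in> sel S A x"
      using clopen_separates_closed[OF alpha5[OF A x] y] by blast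
    finally show ?thesis .
  qed
  have surj: "\<exists>y\<in>pts S. Y = eps S y" if "Y \<in> Ult (C_obj S)" for Y
    using Ult_point_filter[OF that] by (auto simp: eps_def)
  have "(\<forall>y. y \<in> sel S (preimg S (eps S) A') x \<longrightarrow> eps S y \<in> sel (A_obj (C_obj S)) A' (eps S x)) \<and>
      (\<forall>y'. y' \<in> sel (A_obj (C_obj S)) A' (eps S x) \<longrightarrow>
        (\<exists>y. eps S y = y' \<and> y \<in> sel S (preimg S (eps S) A') x))"
    if A': "A' \<in> Cl (A_obj (C_obj S))" and x: "x \<in> pts S" for A' x
  proof -
    obtain A where A: "A \<in> Cl S" "A' = stone_set (C_obj S) A"
      using A' by (auto simp: V.clopens_A_obj)
    have "\<exists>y\<in>pts S. Y = eps S y" if "Y \<in> sel (A_obj (C_obj S)) (stone_set (C_obj S) A) (eps S x)" for Y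
      using that surj A(1) V.sel_A_obj[of A] by simp
    then show ?thesis
      unfolding A(2) preimg_eps[OF A(1)] using sel[OF A(1) x] sel_subset_pts[OF TAM A(1) x] by blast
  qed
  then show ?thesis
    using homeomorphic_imp_continuous_map[OF eps_homeomorphic]
    unfolding alpha_hom_def mem_Collect_eq by (simp add: eps_def)
qed

end

lemma eps_iso:
  assumes "S \<in> TAM"
  shows "eps S \<in> alpha_iso S (A_obj (C_obj S))"
  using assms alpha_model.eps_hom[of S] alpha_model.eps_homeomorphic[of S]
  by (simp add: alpha_isoI TAM_def)

text \<open>Both sides send \<open>x\<close> to the filter of clopens of \<open>T\<close> containing
  the image of \<open>x\<close> under \<phi>.\<close>

lemma eps_natural:
  assumes S: "S \<in> TAM" and T: "T \<in> TAM" and \<phi>: "\<phi> \<in> alpha_hom S T"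
  shows "alpha_comp S (A_map (C_obj T) (C_obj S) (C_map S T \<phi>)) (eps S) = alpha_comp S (eps T) \<phi>"
  unfolding alpha_comp_def compose_def
proof (rule restrict_ext)
  fix x assume x: "x \<in> pts S"
  have "{A \<in> Cl S. x \<in> A} \<in> Ult (C_obj S)"
    using S x alpha_model.point_filter_Ult by (auto simp: TAM_def)
  then show "A_map (C_obj T) (C_obj S) (C_map S T \<phi>) (eps S x) = eps T (\<phi> x)"
    using x alpha_homD(3)[OF \<phi> x] preimg_clopen[OF \<phi>]
    by (auto simp: A_map_def C_map_def eps_def preimg_def)
qed

theorem theorem5p11:
  shows
   "\<comment> \<open>\<open>A\<close> is a contravariant functor from V-algebras to topological alpha-models\<close>
    (\<forall>C\<in>(VAlg :: 'a valg set). A_obj C \<in> TAM) \<and>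
    (\<forall>C\<in>(VAlg :: 'a valg set). \<forall>D\<in>(VAlg :: 'b valg set). \<forall>h\<in>V_hom C D.
        A_map C D h \<in> alpha_hom (A_obj D) (A_obj C)) \<and>
    (\<forall>C\<in>(VAlg :: 'a valg set). A_map C C (V_id C) = alpha_id (A_obj C)) \<and>
    (\<forall>C\<in>(VAlg :: 'a valg set). \<forall>D\<in>(VAlg :: 'b valg set). \<forall>E\<in>(VAlg :: 'c valg set).
      \<forall>h\<in>V_hom C D. \<forall>g\<in>V_hom D E.
        A_map C E (V_comp C g h) = alpha_comp (A_obj E) (A_map C D h) (A_map D E g)) \<and>

    \<comment> \<open>\<open>C\<close> is a contravariant functor from topological alpha-models to V-algebras\<close>
    (\<forall>S\<in>(TAM :: 's amodel set). C_obj S \<in> VAlg) \<and>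
    (\<forall>S\<in>(TAM :: 's amodel set). \<forall>T\<in>(TAM :: 't amodel set). \<forall>\<phi>\<in>alpha_hom S T.
        C_map S T \<phi> \<in> V_hom (C_obj T) (C_obj S)) \<and>
    (\<forall>S\<in>(TAM :: 's amodel set). C_map S S (alpha_id S) = V_id (C_obj S)) \<and>
    (\<forall>S\<in>(TAM :: 's amodel set). \<forall>T\<in>(TAM :: 't amodel set). \<forall>U\<in>(TAM :: 'u amodel set).
      \<forall>\<phi>\<in>alpha_hom S T. \<forall>\<psi>\<in>alpha_hom T U.
        C_map S U (alpha_comp S \<psi> \<phi>) = V_comp (C_obj U) (C_map S T \<phi>) (C_map T U \<psi>)) \<and>

    \<comment> \<open>\<open>eta\<close> is a natural isomorphism from the identity to the composite \<open>C A\<close>\<close>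
    (\<forall>C\<in>(VAlg :: 'a valg set). eta C \<in> V_iso C (C_obj (A_obj C))) \<and>
    (\<forall>C\<in>(VAlg :: 'a valg set). \<forall>D\<in>(VAlg :: 'b valg set). \<forall>h\<in>V_hom C D.
        V_comp C (C_map (A_obj D) (A_obj C) (A_map C D h)) (eta C) = V_comp C (eta D) h) \<and>

    \<comment> \<open>\<open>eps\<close> is a natural isomorphism from the identity to the composite \<open>A C\<close>\<close>
    (\<forall>S\<in>(TAM :: 's amodel set). eps S \<in> alpha_iso S (A_obj (C_obj S))) \<and>
    (\<forall>S\<in>(TAM :: 's amodel set). \<forall>T\<in>(TAM :: 't amodel set). \<forall>\<phi>\<in>alpha_hom S T.
        alpha_comp S (A_map (C_obj T) (C_obj S) (C_map S T \<phi>)) (eps S) = alpha_comp S (eps T) \<phi>)"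
  by (intro conjI ballI V_algebra.A_obj_TAM VAlgD A_map_hom A_map_id A_map_comp C_obj_VAlg
      C_map_hom C_map_id C_map_comp eta_iso eta_natural eps_iso eps_natural)

end
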